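(* Let $\rho$ be a positive weight function on $\mathbb{R}_+=(0,\infty)$ and $t\in\mathbb{R}$ be such that $\int_0^\infty x^i e^{tx}\rho(x)\,dx<\infty$ for all integers $i\ge 0$. For $i,j\ge 0$ put $$\mu_{i,j}(t)=\iint_{\mathbb{R}_+^2}x^iy^j\frac{x-y}{x+y}e^{t(x+y)}\rho(x)\rho(y)\,dx\,dy,\qquad \beta_i(t)=\int_{\mathbb{R}_+}x^ie^{tx}\rho(x)\,dx,$$ and let $\tau_{2n}(t)=Pf(0,1,\dots,2n-1)$, $\tau_{2n+1}(t)=Pf(d_0,0,1,\dots,2n)$ with Pfaffian entries $Pf(i,j)=\mu_{i,j}(t)$, $Pf(d_0,i)=\beta_i(t)$. Then for every $n\ge 1$, $$\tau_n(t)=(-1)^{\lfloor n/2\rfloor}\mathop{\int\cdots\int}\limits_{0<x_1<\cdots<x_n<\infty}\ \prod_{1\le i<j\le n}\frac{(x_j-x_i)^2}{x_i+x_j}\ \prod_{1\le j\le n}e^{tx_j}\rho(x_j)\,dx_1\cdots dx_n .$$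
   Context: Hirota's Pfaffian notation: given symbols $a_1,\dots,a_{2N}$ and prescribed entries $Pf(a_i,a_j)=-Pf(a_j,a_i)$, $Pf(a_1,\dots,a_{2N})$ denotes the Pfaffian of the $2N\times 2N$ skew-symmetric matrix with $(i,j)$ entry $Pf(a_i,a_j)$. $\lfloor a\rfloor$ is the greatest integer at most $a$. *)

theory Defs
  imports "HOL-Analysis.Analysis" "HOL-Combinatorics.Permutations"
begin

text \<open>
  Pfaffian of the \<open>2N \<times> 2N\<close> matrix \<open>(A i j)\<close>, \<open>i, j < 2N\<close>. The formula is the usual one for
  skew-symmetric \<open>A\<close>; it carries no meaning for other arguments.
\<close>
definition pfaffian :: "nat \<Rightarrow> (nat \<Rightarrow> nat \<Rightarrow> 'a::field_char_0) \<Rightarrow> 'a" where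
  "pfaffian N A =
     (\<Sum>p | p permutes {..<2 * N}. of_int (sign p) * (\<Prod>k<N. A (p (2 * k)) (p (2 * k + 1))))
       / (2 ^ N * fact N)"

text \<open>
  Hirota's \<open>Pf(a\<^sub>1, \<dots>, a\<^sub>2\<^sub>N)\<close> for the prescribed entries \<open>e a b = Pf(a, b)\<close>; the list of symbols
  is meant to have even length.
\<close>
definition hirota_Pf :: "('s \<Rightarrow> 's \<Rightarrow> 'a::field_char_0) \<Rightarrow> 's list \<Rightarrow> 'a" where
  "hirota_Pf e as = pfaffian (length as div 2) (\<lambda>i j. e (as ! i) (as ! j))"

definition mu :: "(real \<Rightarrow> real) \<Rightarrow> real \<Rightarrow> nat \<Rightarrow> nat \<Rightarrow> real" where
  "mu \<rho> t i j =
     (LINT z:{0<..} \<times> {0<..}|lborel \<Otimes>\<^sub>M lborel.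
        (case z of (x, y) \<Rightarrow>
          x ^ i * y ^ j * ((x - y) / (x + y)) * exp (t * (x + y)) * \<rho> x * \<rho> y))"

definition beta :: "(real \<Rightarrow> real) \<Rightarrow> real \<Rightarrow> nat \<Rightarrow> real" where
  "beta \<rho> t i = (LINT x:{0<..}|lborel. x ^ i * exp (t * x) * \<rho> x)"

datatype pf_symbol = D0 | Idx nat

text \<open>The entries not prescribed explicitly are those forced by \<open>Pf(a, b) = - Pf(b, a)\<close>.\<close>
fun pf_entry :: "(real \<Rightarrow> real) \<Rightarrow> real \<Rightarrow> pf_symbol \<Rightarrow> pf_symbol \<Rightarrow> real" where
  "pf_entry \<rho> t (Idx i) (Idx j) = mu \<rho> t i j"
| "pf_entry \<rho> t D0 (Idx i) = beta \<rho> t i"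
| "pf_entry \<rho> t (Idx i) D0 = - beta \<rho> t i"
| "pf_entry \<rho> t D0 D0 = 0"

definition tau :: "(real \<Rightarrow> real) \<Rightarrow> real \<Rightarrow> nat \<Rightarrow> real" where
  "tau \<rho> t n =
     (if even n then hirota_Pf (pf_entry \<rho> t) (map Idx [0..<n])
      else hirota_Pf (pf_entry \<rho> t) (D0 # map Idx [0..<n]))"

text \<open>The variables \<open>x\<^sub>1, \<dots>, x\<^sub>n\<close> are the components \<open>x 0, \<dots>, x (n - 1)\<close>.\<close>
definition ordered_chamber :: "nat \<Rightarrow> (nat \<Rightarrow> real) set" where
  "ordered_chamber n = {x. (\<forall>i<n. 0 < x i) \<and> (\<forall>i j. i < j \<and> j < n \<longrightarrow> x i < x j)}"

end

theory Submission
  imports Defs "HOL-Computational_Algebra.Polynomial"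
begin

text \<open>
  Write \<open>s(u, v) = (u - v) / (u + v)\<close> and \<open>w(x) = exp (t x) \<rho>(x)\<close>. Every term of the Pfaffian \<open>\<tau>\<^sub>n\<close> is
  a product of double integrals in which each row index occurs exactly once; attaching the variable
  \<open>x\<^sub>i\<close> to row \<open>i\<close>, all terms share the factor \<open>\<Prod>\<^sub>i x\<^sub>i\<^sup>i w(x\<^sub>i)\<close>, so that
  \<open>\<tau>\<^sub>n = \<integral> \<Prod>\<^sub>i x\<^sub>i\<^sup>i w(x\<^sub>i) Pf(s(x\<^sub>i, x\<^sub>j)) dx\<close>. For odd \<open>n\<close> the row \<open>d\<^sub>0\<close> is a variable frozen at \<open>0\<close>
  with weight \<open>-1\<close>, because \<open>s(0, x) = -1\<close>. Schur's identity turns the inner Pfaffian into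
  \<open>\<Prod>\<^sub>i\<^sub><\<^sub>j s(x\<^sub>i, x\<^sub>j)\<close>, which is antisymmetric. Summing over the \<open>n!\<close> orderings of the coordinates
  restricts the integral to the chamber and turns the monomial into a Vandermonde determinant.
\<close>

section \<open>Antisymmetric products over pairs\<close>

text \<open>The Vandermonde sum and the Schur sum over permutations are evaluated by one scheme: fix
  the value \<open>b\<close> taken at the last position, carry the inductive product through the
  transposition that exchanges \<open>b\<close> with that position, and divide the full product by
  the factors containing \<open>x b\<close>. What remains is a rational identity in the variables,
  proved by interpolation. The Fubini steps for the moments rest on the bound 1 for the kernel at
  nonnegative arguments: each integrand is dominated by a multiple of a product of integrable
  functions of one variable. The sign comes from (x_j - x_i) s(x_i, x_j) = -(x_j - x_i)^2 / (x_i +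
  x_j): there are n(n-1)/2 pairs, a number with the parity of floor(n/2).\<close>

definition pair_prod :: "('a \<Rightarrow> 'a \<Rightarrow> 'b::comm_ring_1) \<Rightarrow> nat \<Rightarrow> (nat \<Rightarrow> 'a) \<Rightarrow> 'b" where
  "pair_prod h n x = (\<Prod>j<n. \<Prod>i<j. h (x i) (x j))"

lemma pair_prod_0 [simp]: "pair_prod h 0 x = 1"
  by (simp add: pair_prod_def)

lemma pair_prod_Suc: "pair_prod h (Suc n) x = pair_prod h n x * (\<Prod>i<n. h (x i) (x n))"
  by (simp add: pair_prod_def)

lemma pair_prod_cong: "(\<And>i. i < n \<Longrightarrow> x i = y i) \<Longrightarrow> pair_prod h n x = pair_prod h n y"
  unfolding pair_prod_def by (intro prod.cong) auto

text \<open>If \<open>b\<close> is not the last index, the factors containing the last variable are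
  merely permuted and induction applies. If the last two variables are exchanged, their factors with
  earlier variables trade places and only the factor for the pair itself changes sign.\<close>

lemma pair_prod_transpose:
  assumes h: "\<And>u v. h v u = - h u v" and "a < b" "b < n"
  shows "pair_prod h n (x \<circ> Transposition.transpose a b) = - pair_prod h n x"
  using \<open>a < b\<close> \<open>b < n\<close>
proof (induction n arbitrary: a b x)
  case 0
  then show ?case by simp
next
  case (Suc n)
  have below: "pair_prod h (Suc n) (y \<circ> Transposition.transpose a b) = - pair_prod h (Suc n) y"
    if ab: "a < b" "b < n" for a b y
  proof -
    have "(\<Prod>i<n. h ((y \<circ> Transposition.transpose a b) i) (y n)) = (\<Prod>i<n. h (y i) (y n))"
      using permutes_swap_id[of a "{..<n}" b] ab
        prod.permute[of "Transposition.transpose a b" "{..<n}" "\<lambda>i. h (y i) (y n)"]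
      by (simp add: o_def)
    moreover have "(y \<circ> Transposition.transpose a b) n = y n"
      using ab by simp
    ultimately show ?thesis
      using Suc.IH[OF ab, of y] by (simp add: pair_prod_Suc o_def)
  qed
  have last_two: "pair_prod h (Suc n) (y \<circ> Transposition.transpose m n) = - pair_prod h (Suc n) y"
    if n: "n = Suc m" for m y
  proof -
    let ?z = "y \<circ> Transposition.transpose m n"
    have z: "?z m = y n" "?z n = y m" "\<And>i. i < m \<Longrightarrow> ?z i = y i"
      using n by auto
    have "pair_prod h m ?z = pair_prod h m y"
      by (intro pair_prod_cong z)
    moreover have "(\<Prod>i<m. h (?z i) v) = (\<Prod>i<m. h (y i) v)" for v
      by (intro prod.cong) (simp_all add: z del: o_apply)
    ultimately show ?thesis
      using h[of "y n" "y m"] z n by (simp add: pair_prod_Suc del: o_apply)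
  qed
  show ?case
  proof (cases "b < n")
    case True
    then show ?thesis using below Suc.prems by blast
  next
    case False
    with Suc.prems obtain m where b: "b = n" and m: "n = Suc m" and am: "a \<le> m"
      by (cases n) auto
    show ?thesis
    proof (cases "a = m")
      case True
      then show ?thesis using last_two[OF m] b by (simp del: o_apply)
    next
      case False
      with am have am: "a < m" by simp
      \<comment> \<open>Conjugation reduces the remaining case to the two settled ones; three sign
        changes amount to one.\<close>
      have "Transposition.transpose a n = Transposition.transpose a m \<circ> Transposition.transpose m n \<circ> Transposition.transpose a m"
        using am m by (auto simp: fun_eq_iff Transposition.transpose_def)
      then have "x \<circ> Transposition.transpose a b = x \<circ> Transposition.transpose a m \<circ> Transposition.transpose m n \<circ> Transposition.transpose a m"
        using b by (simp add: o_assoc)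
      then show ?thesis
        using below[of a m] last_two[OF m] am m by (simp del: o_apply)
    qed
  qed
qed

lemma pair_prod_permutes:
  assumes h: "\<And>u v. h v u = - h u v" and p: "p permutes {..<n}"
  shows "pair_prod h n (x \<circ> p) = of_int (sign p) * pair_prod h n x"
proof -
  have "finite {..<n}" by simp
  then show ?thesis using p
  proof (induction rule: permutes_rev_induct)
    case id
    then show ?case by simp
  next
    case (swap a b p)
    have "pair_prod h n ((x \<circ> p) \<circ> Transposition.transpose a b) = - pair_prod h n (x \<circ> p)"
    proof (cases "a < b")
      case True
      then show ?thesis using pair_prod_transpose[OF h, of a b] swap by simp
    next
      case False
      then show ?thesis using pair_prod_transpose[OF h, of b a] swap
        by (simp add: transpose_commute)
    qed
    moreover have "sign (p \<circ> Transposition.transpose a b) = - sign p"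
      using swap permutes_imp_permutation[OF _ swap.hyps(4)]
      by (simp add: sign_compose permutation_swap_id sign_swap_id)
    ultimately show ?case using swap.IH by (simp add: o_assoc del: o_apply)
  qed
qed

text \<open>Moving \<open>x b\<close> to the last place splits the product into the pairs without
  \<open>x b\<close> and the pairs with it, at the cost of the sign of the transposition. This is
  the counterpart of a cofactor expansion: it expresses the inductive product as the full product
  divided by the factors containing \<open>x b\<close>.\<close>

lemma pair_prod_cofactor:
  assumes h: "\<And>u v. h v u = - h u v" and b: "b \<le> n"
  shows "of_int (sign (Transposition.transpose n b)) * pair_prod h n (x \<circ> Transposition.transpose n b) *
      (\<Prod>i\<in>{..n}-{b}. h (x i) (x b))
    = pair_prod h (Suc n) x"
proof -
  let ?\<tau> = "Transposition.transpose n b"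
  have \<tau>: "?\<tau> permutes {..<Suc n}"
    using b by (intro permutes_swap_id) auto
  have "inj_on ?\<tau> {..<n}"
    by (metis inj_on_subset inj_transpose subset_UNIV)
  moreover have "?\<tau> ` {..<n} = {..n} - {b}"
  proof -
    have "{..<n} = {..n} - {n}" by auto
    then have "?\<tau> ` {..<n} = ?\<tau> ` {..n} - {b}"
      by (simp add: image_set_diff inj_transpose)
    moreover have "?\<tau> ` {..n} = {..n}"
      using permutes_image[OF \<tau>] by (simp add: lessThan_Suc_atMost)
    ultimately show ?thesis by simp
  qed
  ultimately have "(\<Prod>i\<in>{..n}-{b}. h (x i) (x b)) = (\<Prod>i<n. h (x (?\<tau> i)) (x b))"
    using prod.reindex[of ?\<tau> "{..<n}" "\<lambda>i. h (x i) (x b)"] by (simp add: o_def)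
  then have "pair_prod h n (x \<circ> ?\<tau>) * (\<Prod>i\<in>{..n}-{b}. h (x i) (x b))
      = of_int (sign ?\<tau>) * pair_prod h (Suc n) x"
    using pair_prod_permutes[OF h \<tau>, where x = x] by (simp add: pair_prod_Suc)
  \<comment> \<open>The sign now occurs twice and squares to 1.\<close>
  then show ?thesis
    by (simp add: mult.assoc flip: of_int_mult) (simp flip: mult.assoc of_int_mult)
qed

text \<open>A permutation with value \<open>b\<close> at \<open>n\<close> factors uniquely as the
  transposition of \<open>n\<close> and \<open>b\<close> after a permutation that fixes
  \<open>n\<close>.\<close>

lemma sum_permutations_lessThan_Suc:
  "(\<Sum>p | p permutes {..<Suc n}. of_int (sign p) * F p :: 'b::comm_ring_1) =
   (\<Sum>b\<le>n. \<Sum>q | q permutes {..<n}. of_int (sign (Transposition.transpose n b)) * (of_int (sign q) * F (Transposition.transpose n b \<circ> q)))"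
proof -
  have "sign (Transposition.transpose n b \<circ> q) = sign (Transposition.transpose n b) * sign q" if "q permutes {..<n}" for q b
    using permutes_imp_permutation[OF _ that] by (simp add: sign_compose permutation_swap_id)
  moreover have "insert n {..<n} = {..n}" by auto
  ultimately show ?thesis
    using sum_over_permutations_insert[of "{..<n}" n "\<lambda>p. of_int (sign p) * F p"]
    by (simp add: lessThan_Suc mult.assoc)
qed

section \<open>Interpolation identities\<close>

text \<open>Subtracting the multiple of the monic product with the same top coefficient leaves a
  polynomial of degree below \<open>card I\<close> that still has \<open>card I\<close>
  roots.\<close>

lemma poly_vanishing_on:
  fixes P :: "'a::idom poly"
  assumes "finite I" "inj_on r I" and deg: "degree P \<le> card I" and zero: "\<And>i. i \<in> I \<Longrightarrow> poly P (r i) = 0"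
  shows "P = smult (coeff P (card I)) (\<Prod>i\<in>I. [:- r i, 1:])"
proof -
  let ?R = "\<Prod>i\<in>I. [:- r i, 1:]"
  define Q where "Q = P - smult (coeff P (card I)) ?R"
  have degR: "degree ?R = card I"
    by (simp add: degree_prod_sum_eq)
  moreover have "lead_coeff ?R = 1"
    by (subst lead_coeff_prod) simp
  ultimately have "coeff Q (card I) = 0" "degree Q \<le> card I"
    using deg by (auto simp: Q_def intro!: degree_diff_le)
  moreover have "card I \<le> degree Q" if "Q \<noteq> 0"
  proof -
    have "r ` I \<subseteq> {a. poly Q a = 0}"
      using zero \<open>finite I\<close> by (auto simp: Q_def poly_prod prod_zero)
    then have "card (r ` I) \<le> card {a. poly Q a = 0}"
      by (intro card_mono poly_roots_finite that)
    then show ?thesis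
      using card_poly_roots_bound[OF that] \<open>inj_on r I\<close> by (simp add: card_image)
  qed
  ultimately have "Q = 0"
    by (metis le_antisym leading_coeff_0_iff)
  then show ?thesis by (simp add: Q_def)
qed

text \<open>
  Cleared of denominators in \<open>y\<close>, the two sides are polynomials of degree \<open>card I\<close> that agree at all
  \<open>- x i\<close>; the remaining constant is fixed by comparing leading coefficients with the values at \<open>0\<close>.
\<close>
lemma schur_partial_fractions:
  fixes x :: "'i \<Rightarrow> real"
  assumes fin: "finite I" and inj: "inj_on x I" and pos: "\<And>i. i \<in> I \<Longrightarrow> x i > 0"
    and y: "\<And>i. i \<in> I \<Longrightarrow> x i + y \<noteq> 0" and odd: "odd (card I)"
  shows "(\<Sum>b\<in>I. (x b - y) / (x b + y) * (\<Prod>i\<in>I-{b}. (x i + x b) / (x i - x b)))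
    = (\<Prod>i\<in>I. (x i - y) / (x i + y))"
proof -
  \<comment> \<open>\<open>r b\<close> is the coefficient dictated by y = - x b, where after
    clearing denominators only the summand for \<open>b\<close> survives.\<close>
  define r where "r b = (\<Prod>i\<in>I-{b}. (x i + x b) / (x i - x b))" for b
  define K where "K = sum r I"
  define P where "P = (\<Sum>b\<in>I. smult (r b) ([:x b, -1:] * (\<Prod>i\<in>I-{b}. [:x i, 1:]))) - (\<Prod>i\<in>I. [:x i, -1:])"
  have deg1: "degree ([:x b, -1:] * (\<Prod>i\<in>I-{b}. [:x i, 1:])) = card I"
    and lead1: "coeff ([:x b, -1:] * (\<Prod>i\<in>I-{b}. [:x i, 1:])) (card I) = -1" if "b \<in> I" for b
  proof -
    have "degree (\<Prod>i\<in>I-{b}. [:x i, 1:]) = card (I - {b})"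
      by (simp add: degree_prod_sum_eq)
    moreover have "card (I - {b}) + 1 = card I"
      using that fin by (metis Suc_eq_plus1 card_Suc_Diff1)
    moreover have "(\<Prod>i\<in>I-{b}. [:x i, 1:]) \<noteq> 0"
      using fin by (subst prod_zero_iff) auto
    ultimately show deg: "degree ([:x b, -1:] * (\<Prod>i\<in>I-{b}. [:x i, 1:])) = card I"
      by (subst degree_mult_eq) auto
    have "lead_coeff ([:x b, -1:] * (\<Prod>i\<in>I-{b}. [:x i, 1:])) = -1"
      by (subst lead_coeff_mult, subst lead_coeff_prod) simp
    then show "coeff ([:x b, -1:] * (\<Prod>i\<in>I-{b}. [:x i, 1:])) (card I) = -1"
      by (simp only: deg)
  qed
  have deg2: "degree (\<Prod>i\<in>I. [:x i, -1:]) = card I"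
    by (simp add: degree_prod_sum_eq)
  \<comment> \<open>Oddness of \<open>card I\<close> enters through this sign: it makes the top
    coefficient of \<open>P\<close> equal to 1 - K.\<close>
  have "lead_coeff (\<Prod>i\<in>I. [:x i, -1:]) = -1"
    using odd by (subst lead_coeff_prod) simp
  then have lead2: "coeff (\<Prod>i\<in>I. [:x i, -1:]) (card I) = -1"
    by (simp only: deg2)
  have degP: "degree P \<le> card I"
    unfolding P_def using deg1 deg2
    by (intro degree_diff_le degree_sum_le fin) (auto intro: order.trans[OF degree_smult_le])
  have "coeff P (card I) = (\<Sum>b\<in>I. r b * (-1)) - (-1)"
    unfolding P_def coeff_diff coeff_sum coeff_smult
    by (intro arg_cong2[of _ _ _ _ "(-)"] sum.cong refl) (simp_all only: lead1 lead2)
  then have coeffP: "coeff P (card I) = 1 - K"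
    by (simp add: K_def sum_negf)
  have root: "poly P (- x b) = 0" if b: "b \<in> I" for b
  proof -
    have "poly (smult (r c) ([:x c, -1:] * (\<Prod>i\<in>I-{c}. [:x i, 1:]))) (- x b) = 0" if "c \<in> I" "c \<noteq> b" for c
    proof -
      have "(\<Prod>i\<in>I-{c}. x i - x b) = 0"
        using that b fin by (intro prod_zero) auto
      then show ?thesis by (simp add: poly_prod)
    qed
    then have "poly P (- x b) = poly (smult (r b) ([:x b, -1:] * (\<Prod>i\<in>I-{b}. [:x i, 1:]))) (- x b)
        - (\<Prod>i\<in>I. x i + x b)"
      using b fin by (simp add: P_def poly_sum poly_prod sum.remove[of I b] del: poly_smult poly_mult)
    also have "\<dots> = (x b + x b) * (r b * (\<Prod>i\<in>I-{b}. x i - x b)) - (\<Prod>i\<in>I. x i + x b)"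
      by (simp add: poly_prod)
    also have "r b * (\<Prod>i\<in>I-{b}. x i - x b) = (\<Prod>i\<in>I-{b}. x i + x b)"
      unfolding r_def prod.distrib[symmetric]
      using inj b by (intro prod.cong) (auto simp: inj_on_def)
    also have "(x b + x b) * (\<Prod>i\<in>I-{b}. x i + x b) = (\<Prod>i\<in>I. x i + x b)"
      using b fin by (simp add: prod.remove)
    finally show ?thesis by simp
  qed
  have P: "P = smult (1 - K) (\<Prod>i\<in>I. [:x i, 1:])"
    using poly_vanishing_on[OF fin _ degP, of "\<lambda>i. - x i"] root inj coeffP
    by (simp add: inj_on_def)
  \<comment> \<open>At 0 the definition of \<open>P\<close> gives K - 1 times the product of the
    nodes, while the factored form gives 1 - K times the same nonzero product. Hence K = 1 and
    \<open>P\<close> vanishes.\<close>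
  have "poly P 0 = (\<Sum>b\<in>I. r b * (x b * (\<Prod>i\<in>I-{b}. x i))) - (\<Prod>i\<in>I. x i)"
    by (simp add: P_def poly_sum poly_prod)
  also have "\<dots> = (K - 1) * (\<Prod>i\<in>I. x i)"
    using fin by (simp add: K_def left_diff_distrib sum_distrib_right flip: prod.remove)
  finally have "(K - 1) * (\<Prod>i\<in>I. x i) = (1 - K) * (\<Prod>i\<in>I. x i)"
    using P by (simp add: poly_prod)
  moreover have "(\<Prod>i\<in>I. x i) \<noteq> 0"
    using pos fin by (force simp: prod_zero_iff)
  ultimately have "K = 1" by simp
  then have "poly P y = 0" using P by simp
  then have "(\<Prod>i\<in>I. x i - y) = (\<Sum>b\<in>I. r b * ((x b - y) * (\<Prod>i\<in>I-{b}. x i + y)))"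
    by (simp add: P_def poly_sum poly_prod left_diff_distrib)
  also have "\<dots> = (\<Sum>b\<in>I. (x b - y) / (x b + y) * r b * (\<Prod>i\<in>I. x i + y))"
  proof (intro sum.cong refl)
    fix b assume b: "b \<in> I"
    show "r b * ((x b - y) * (\<Prod>i\<in>I-{b}. x i + y)) = (x b - y) / (x b + y) * r b * (\<Prod>i\<in>I. x i + y)"
      using y[OF b] by (simp add: prod.remove[OF fin b])
  qed
  finally have "(\<Prod>i\<in>I. x i - y) = (\<Sum>b\<in>I. (x b - y) / (x b + y) * r b) * (\<Prod>i\<in>I. x i + y)"
    by (simp add: sum_distrib_right)
  moreover have "(\<Prod>i\<in>I. x i + y) \<noteq> 0"
    using y fin by (simp add: prod_zero_iff)
  ultimately show ?thesis
    by (simp add: r_def prod_dividef)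
qed

text \<open>Lagrange interpolation of the monomial \<open>y\<^sup>n\<close> at \<open>n + 1\<close> nodes, comparing leading coefficients.\<close>
lemma sum_power_over_differences:
  fixes x :: "'i \<Rightarrow> 'a::field"
  assumes fin: "finite I" and inj: "inj_on x I" and card: "card I = Suc n"
  shows "(\<Sum>b\<in>I. x b ^ n / (\<Prod>i\<in>I-{b}. x b - x i)) = 1"
proof -
  define c where "c b = x b ^ n / (\<Prod>i\<in>I-{b}. x b - x i)" for b
  define L where "L b = (\<Prod>i\<in>I-{b}. [:- x i, 1:])" for b
  define P where "P = (\<Sum>b\<in>I. smult (c b) (L b)) - monom 1 n"
  have degL: "degree (L b) = n" and leadL: "coeff (L b) n = 1" if "b \<in> I" for b
  proof -
    show deg: "degree (L b) = n"
      using that fin card by (simp add: L_def degree_prod_sum_eq)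
    have "lead_coeff (L b) = 1"
      unfolding L_def by (subst lead_coeff_prod) simp
    then show "coeff (L b) n = 1" by (simp only: deg)
  qed
  have degP: "degree P \<le> n"
    unfolding P_def using degL
    by (intro degree_diff_le degree_sum_le fin degree_monom_le) (auto intro: order.trans[OF degree_smult_le])
  have root: "poly P (x b) = 0" if b: "b \<in> I" for b
  proof -
    have L0: "poly (L a) (x b) = 0" if "a \<in> I" "a \<noteq> b" for a
      unfolding L_def poly_prod using that b fin by (intro prod_zero) auto
    have "(\<Prod>i\<in>I-{b}. x b - x i) \<noteq> 0"
      using fin inj b by (auto simp: prod_zero_iff inj_on_def)
    then have "c b * poly (L b) (x b) = x b ^ n"
      by (simp add: c_def L_def poly_prod)
    then show ?thesis
      using b fin L0 by (simp add: P_def poly_sum poly_monom sum.remove[of I b])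
  qed
  \<comment> \<open>The degree is at most \<open>n\<close>, but there are \<open>n + 1\<close>
    roots.\<close>
  have "P = 0"
    using poly_vanishing_on[OF fin inj _ root] degP card by (simp add: coeff_eq_0)
  then have "(\<Sum>b\<in>I. c b * coeff (L b) n) = 1"
    by (metis (no_types, lifting) P_def coeff_0 coeff_diff coeff_monom coeff_smult coeff_sum eq_iff_diff_eq_0 sum.cong)
  then show ?thesis
    by (simp add: leadL c_def)
qed

section \<open>The Vandermonde determinant and Schur's Pfaffian\<close>

text \<open>Expansion by the variable \<open>x b\<close> that carries the top power
  \<open>n\<close>: by \<open>pair_prod_cofactor\<close> the cofactor is the full product divided by
  the differences with \<open>x b\<close>, so the sum over \<open>b\<close> is
  \<open>sum_power_over_differences\<close>.\<close>

lemma vandermonde_sum_permutations: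
  fixes x :: "nat \<Rightarrow> 'a::field"
  assumes "inj_on x {..<n}"
  shows "(\<Sum>q | q permutes {..<n}. of_int (sign q) * (\<Prod>i<n. x (q i) ^ i))
    = pair_prod (\<lambda>u v. v - u) n x"
  using assms
proof (induction n arbitrary: x)
  case 0
  then show ?case by simp
next
  case (Suc n)
  define h where "h = (\<lambda>u v :: 'a. v - u)"
  have anti: "h v u = - h u v" for u v by (simp add: h_def)
  have inj: "inj_on x {..n}"
    using Suc.prems by (simp add: lessThan_Suc_atMost)
  have "(\<Sum>q | q permutes {..<Suc n}. of_int (sign q) * (\<Prod>i<Suc n. x (q i) ^ i))
      = (\<Sum>b\<le>n. of_int (sign (Transposition.transpose n b)) *
          (\<Sum>q | q permutes {..<n}. of_int (sign q) * (\<Prod>i<n. (x \<circ> Transposition.transpose n b) (q i) ^ i)) * x b ^ n)"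
    unfolding sum_permutations_lessThan_Suc sum_distrib_left sum_distrib_right
    by (intro sum.cong refl) (simp add: permutes_not_in mult.assoc)
  also have "\<dots> = (\<Sum>b\<le>n. of_int (sign (Transposition.transpose n b)) * pair_prod h n (x \<circ> Transposition.transpose n b) * x b ^ n)"
  proof (intro sum.cong refl arg_cong2[of _ _ _ _ "(*)"])
    fix b assume b: "b \<in> {..n}"
    have "Transposition.transpose n b permutes {..n}"
      using b by (intro permutes_swap_id) auto
    then have "inj_on (x \<circ> Transposition.transpose n b) {..n}"
      using inj by (intro comp_inj_on) (auto simp: permutes_image intro: permutes_inj_on)
    then have "inj_on (x \<circ> Transposition.transpose n b) {..<n}"
      by (rule inj_on_subset) auto
    then show "(\<Sum>q | q permutes {..<n}. of_int (sign q) * (\<Prod>i<n. (x \<circ> Transposition.transpose n b) (q i) ^ i))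
        = pair_prod h n (x \<circ> Transposition.transpose n b)"
      unfolding h_def by (rule Suc.IH)
  qed
  also have "\<dots> = (\<Sum>b\<le>n. pair_prod h (Suc n) x * (x b ^ n / (\<Prod>i\<in>{..n}-{b}. x b - x i)))"
  proof (intro sum.cong refl)
    fix b assume b: "b \<in> {..n}"
    have "(\<Prod>i\<in>{..n}-{b}. x b - x i) \<noteq> 0"
      using inj b by (auto simp: prod_zero_iff inj_on_def)
    then show "of_int (sign (Transposition.transpose n b)) * pair_prod h n (x \<circ> Transposition.transpose n b) * x b ^ n
        = pair_prod h (Suc n) x * (x b ^ n / (\<Prod>i\<in>{..n}-{b}. x b - x i))"
      using pair_prod_cofactor[of h b n x] anti b by (simp add: h_def field_simps)
  qed
  also have "\<dots> = pair_prod h (Suc n) x"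
    using sum_power_over_differences[OF _ inj, of n] by (simp only: sum_distrib_left[symmetric]) simp
  finally show ?case by (simp add: h_def)
qed

section \<open>Schur's Pfaffian identity\<close>

definition schur_ratio :: "real \<Rightarrow> real \<Rightarrow> real" where
  "schur_ratio u v = (u - v) / (u + v)"

lemma schur_ratio_antisym: "schur_ratio v u = - schur_ratio u v"
  by (simp add: schur_ratio_def add.commute minus_divide_left)

text \<open>Two positions are peeled off in each step. By antisymmetry every value at the last
  position contributes equally; summing over the value of its partner is
  \<open>schur_partial_fractions\<close>, applied to an odd number of nodes. Distinct positive
  points keep all denominators away from 0.\<close>

lemma schur_pfaffian_positive:
  assumes "inj_on x {..<2 * N}" and "\<And>i. i < 2 * N \<Longrightarrow> x i > 0"
  shows "(\<Sum>p | p permutes {..<2 * N}. of_int (sign p) * (\<Prod>k<N. schur_ratio (x (p (2 * k))) (x (p (2 * k + 1)))))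
    = 2 ^ N * fact N * pair_prod schur_ratio (2 * N) x"
  using assms
proof (induction N arbitrary: x)
  case 0
  then show ?case by simp
next
  case (Suc N)
  define L where "L = 2 * N"
  have L: "2 * Suc N = Suc (Suc L)" "Suc (2 * N) = Suc L" by (auto simp: L_def)
  define T where "T x p = (\<Prod>k<Suc N. schur_ratio (x (p (2 * k))) (x (p (2 * k + 1))))" for x :: "nat \<Rightarrow> real" and p
  \<comment> \<open>The sum over permutations that fix the last position
    \<open>Suc L\<close>.\<close>
  have inner: "(\<Sum>q | q permutes {..<Suc L}. of_int (sign q) * T x q) = 2 ^ N * fact N * pair_prod schur_ratio (Suc (Suc L)) x"
    if inj: "inj_on x {..<Suc (Suc L)}" and pos: "\<And>i. i < Suc (Suc L) \<Longrightarrow> x i > 0" for x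
  proof -
    let ?\<tau> = "\<lambda>b. Transposition.transpose L b"
    have inj': "inj_on x {..L}"
      using inj by (rule inj_on_subset) auto
    have posL: "x i > 0" if "i \<le> Suc L" for i
      using pos that by simp
    have "(\<Sum>q | q permutes {..<Suc L}. of_int (sign q) * T x q)
        = (\<Sum>b\<le>L. of_int (sign (?\<tau> b)) *
          (\<Sum>q | q permutes {..<L}. of_int (sign q) * (\<Prod>k<N. schur_ratio ((x \<circ> ?\<tau> b) (q (2 * k))) ((x \<circ> ?\<tau> b) (q (2 * k + 1)))))
            * schur_ratio (x b) (x (Suc L)))"
      unfolding sum_permutations_lessThan_Suc sum_distrib_left sum_distrib_right
    proof (intro sum.cong refl)
      fix b q assume "b \<in> {..L}" "q \<in> {q. q permutes {..<L}}"
      \<comment> \<open>Since \<open>q\<close> moves only indices below \<open>L\<close>, the factor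
        for k = N pairs \<open>x b\<close> with the last variable, and the other factors form the
        sum of the induction hypothesis.\<close>
      then have "q (2 * N) = L" "q (Suc (2 * N)) = Suc L" "?\<tau> b (Suc L) = Suc L"
        unfolding L_def by (auto simp: permutes_not_in Transposition.transpose_def)
      then show "of_int (sign (?\<tau> b)) * (of_int (sign q) * T x (?\<tau> b \<circ> q)) =
         of_int (sign (?\<tau> b)) * (of_int (sign q) * (\<Prod>k<N. schur_ratio ((x \<circ> ?\<tau> b) (q (2 * k))) ((x \<circ> ?\<tau> b) (q (2 * k + 1)))))
            * schur_ratio (x b) (x (Suc L))"
        by (simp add: T_def)
    qed
    also have "\<dots> = (\<Sum>b\<le>L. of_int (sign (?\<tau> b)) * (2 ^ N * fact N * pair_prod schur_ratio L (x \<circ> ?\<tau> b)) * schur_ratio (x b) (x (Suc L)))"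
    proof (intro sum.cong refl arg_cong2[of _ _ _ _ "(*)"])
      fix b assume b: "b \<in> {..L}"
      have \<tau>: "?\<tau> b permutes {..L}"
        using b by (intro permutes_swap_id) auto
      then have "inj_on (x \<circ> ?\<tau> b) {..L}"
        using inj' by (intro comp_inj_on) (auto simp: permutes_image intro: permutes_inj_on)
      then have "inj_on (x \<circ> ?\<tau> b) {..<2 * N}"
        by (rule inj_on_subset) (auto simp: L_def)
      moreover have "(x \<circ> ?\<tau> b) i > 0" if "i < 2 * N" for i
        using b that posL by (auto simp: L_def Transposition.transpose_def)
      ultimately show "(\<Sum>q | q permutes {..<L}. of_int (sign q) * (\<Prod>k<N. schur_ratio ((x \<circ> ?\<tau> b) (q (2 * k))) ((x \<circ> ?\<tau> b) (q (2 * k + 1)))))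
          = 2 ^ N * fact N * pair_prod schur_ratio L (x \<circ> ?\<tau> b)"
        unfolding L_def by (rule Suc.IH)
    qed
    also have "\<dots> = (\<Sum>b\<le>L. 2 ^ N * fact N * pair_prod schur_ratio (Suc L) x *
        ((x b - x (Suc L)) / (x b + x (Suc L)) * (\<Prod>i\<in>{..L}-{b}. (x i + x b) / (x i - x b))))"
    proof (intro sum.cong refl)
      fix b assume b: "b \<in> {..L}"
      have "x i - x b \<noteq> 0" "x i + x b \<noteq> 0" if "i \<in> {..L}-{b}" for i
        using that inj' b posL[of i] posL[of b] by (auto simp: inj_on_def)
      \<comment> \<open>The weights in \<open>schur_partial_fractions\<close> are exactly the
        reciprocals of the factors that \<open>pair_prod_cofactor\<close> attaches to
        \<open>x b\<close>.\<close>
      then have inverse: "(\<Prod>i\<in>{..L}-{b}. schur_ratio (x i) (x b)) * (\<Prod>i\<in>{..L}-{b}. (x i + x b) / (x i - x b)) = 1"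
        unfolding prod.distrib[symmetric] by (intro prod.neutral) (auto simp: schur_ratio_def)
      have "of_int (sign (?\<tau> b)) * pair_prod schur_ratio L (x \<circ> ?\<tau> b) * (\<Prod>i\<in>{..L}-{b}. schur_ratio (x i) (x b))
          = pair_prod schur_ratio (Suc L) x"
        using b by (intro pair_prod_cofactor schur_ratio_antisym) simp
      moreover have "s * (c * Q) * z = c * D * (z * R)" if "S * R = 1" "s * Q * S = D" for s c Q z D R S :: real
        using that by algebra
      ultimately show "of_int (sign (?\<tau> b)) * (2 ^ N * fact N * pair_prod schur_ratio L (x \<circ> ?\<tau> b)) * schur_ratio (x b) (x (Suc L)) =
        2 ^ N * fact N * pair_prod schur_ratio (Suc L) x *
        ((x b - x (Suc L)) / (x b + x (Suc L)) * (\<Prod>i\<in>{..L}-{b}. (x i + x b) / (x i - x b)))"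
        unfolding schur_ratio_def[of "x b" "x (Suc L)"] using inverse by blast
    qed
    also have "\<dots> = 2 ^ N * fact N * pair_prod schur_ratio (Suc L) x * (\<Prod>i\<le>L. schur_ratio (x i) (x (Suc L)))"
    proof -
      have "x i + x (Suc L) \<noteq> 0" if "i \<in> {..L}" for i
        using posL[of i] posL[of "Suc L"] that by auto
      then have "(\<Sum>b\<le>L. (x b - x (Suc L)) / (x b + x (Suc L)) * (\<Prod>i\<in>{..L}-{b}. (x i + x b) / (x i - x b)))
          = (\<Prod>i\<le>L. schur_ratio (x i) (x (Suc L)))"
        unfolding schur_ratio_def using posL
        by (intro schur_partial_fractions inj') (auto simp: L_def)
      then show ?thesis by (simp only: sum_distrib_left[symmetric])
    qed
    finally show ?thesis
      by (simp only: pair_prod_Suc[of _ "Suc L"] mult.assoc lessThan_Suc_atMost)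
  qed
  have "(\<Sum>p | p permutes {..<2 * Suc N}. of_int (sign p) * T x p)
     = (\<Sum>b\<le>Suc L. of_int (sign (Transposition.transpose (Suc L) b)) *
          (\<Sum>q | q permutes {..<Suc L}. of_int (sign q) * T (x \<circ> Transposition.transpose (Suc L) b) q))"
    unfolding L(1) sum_distrib_left by (subst sum_permutations_lessThan_Suc) (simp only: T_def o_apply)
  also have "\<dots> = (\<Sum>b\<le>Suc L. 2 ^ N * fact N * pair_prod schur_ratio (Suc (Suc L)) x)"
  proof (intro sum.cong refl)
    fix b assume b: "b \<in> {..Suc L}"
    let ?\<tau> = "Transposition.transpose (Suc L) b"
    have \<tau>: "?\<tau> permutes {..<Suc (Suc L)}"
      using b by (intro permutes_swap_id) auto
    have "inj_on (x \<circ> ?\<tau>) {..<Suc (Suc L)}"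
      using Suc.prems(1) \<tau> unfolding L
      by (intro comp_inj_on) (auto simp: permutes_image intro: permutes_inj_on)
    moreover have "(x \<circ> ?\<tau>) i > 0" if "i < Suc (Suc L)" for i
      using Suc.prems(2) that permutes_in_image[OF \<tau>, of i] unfolding L by simp
    ultimately have "(\<Sum>q | q permutes {..<Suc L}. of_int (sign q) * T (x \<circ> ?\<tau>) q)
        = 2 ^ N * fact N * pair_prod schur_ratio (Suc (Suc L)) (x \<circ> ?\<tau>)"
      by (rule inner)
    also have "\<dots> = of_int (sign ?\<tau>) * (2 ^ N * fact N * pair_prod schur_ratio (Suc (Suc L)) x)"
      using pair_prod_permutes[OF schur_ratio_antisym \<tau>, where x = x] by simp
    finally show "of_int (sign ?\<tau>) * (\<Sum>q | q permutes {..<Suc L}. of_int (sign q) * T (x \<circ> ?\<tau>) q)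
        = 2 ^ N * fact N * pair_prod schur_ratio (Suc (Suc L)) x"
      by (simp flip: mult.assoc of_int_mult)
  qed
  also have "\<dots> = 2 ^ Suc N * fact (Suc N) * pair_prod schur_ratio (2 * Suc N) x"
  proof -
    \<comment> \<open>The number of values available at the last position supplies the factor by
      which \<open>2 ^ N * fact N\<close> grows.\<close>
    have "real (card {..Suc L}) = 2 * real (Suc N)"
      by (simp add: L_def)
    then show ?thesis
      unfolding L(1) sum_constant by (simp only: power_Suc fact_Suc mult_ac)
  qed
  finally show ?case by (simp only: T_def)
qed

text \<open>Degenerate arguments are limits of \<open>x i + (i + 1) \<epsilon>\<close>, which are positive and distinct for small \<open>\<epsilon> > 0\<close>.\<close>
lemma schur_pfaffian:
  assumes nonneg: "\<And>i. i < 2 * N \<Longrightarrow> x i \<ge> 0"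
    and pos: "\<And>i j. i < 2 * N \<Longrightarrow> j < 2 * N \<Longrightarrow> i \<noteq> j \<Longrightarrow> x i + x j > 0"
  shows "pfaffian N (\<lambda>i j. schur_ratio (x i) (x j)) = pair_prod schur_ratio (2 * N) x"
proof -
  define y where "y \<epsilon> i = x i + \<epsilon> * real (i + 1)" for \<epsilon> i
  have y_lim: "((\<lambda>\<epsilon>. y \<epsilon> i) \<longlongrightarrow> x i) (at_right 0)" for i
    unfolding y_def by (auto intro!: tendsto_eq_intros)
  have s_lim: "((\<lambda>\<epsilon>. schur_ratio (y \<epsilon> i) (y \<epsilon> j)) \<longlongrightarrow> schur_ratio (x i) (x j)) (at_right 0)"
    if "i < 2 * N" "j < 2 * N" "i \<noteq> j" for i j
    unfolding schur_ratio_def using pos[OF that] by (intro tendsto_intros y_lim) auto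
  have distinct: "eventually (\<lambda>\<epsilon>. y \<epsilon> i \<noteq> y \<epsilon> j) (at_right 0)" if "i \<noteq> j" for i j
  proof (cases "x i = x j")
    case True
    have "eventually (\<lambda>\<epsilon>::real. \<epsilon> > 0) (at_right 0)"
      by (rule eventually_at_right_less)
    then show ?thesis
      by eventually_elim (use that True in \<open>auto simp: y_def\<close>)
  next
    case False
    have "((\<lambda>\<epsilon>. y \<epsilon> i - y \<epsilon> j) \<longlongrightarrow> x i - x j) (at_right 0)"
      by (intro tendsto_intros y_lim)
    then have "eventually (\<lambda>\<epsilon>. y \<epsilon> i - y \<epsilon> j \<noteq> 0) (at_right 0)"
      by (rule tendsto_imp_eventually_ne) (use False in auto)
    then show ?thesis by eventually_elim auto
  qed
  have "eventually (\<lambda>\<epsilon>. \<forall>(i, j)\<in>{..<2*N} \<times> {..<2*N}. i \<noteq> j \<longrightarrow> y \<epsilon> i \<noteq> y \<epsilon> j) (at_right 0)"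
  proof (rule eventually_ball_finite)
    show "\<forall>z\<in>{..<2*N} \<times> {..<2*N}. eventually (\<lambda>\<epsilon>. case z of (i, j) \<Rightarrow> i \<noteq> j \<longrightarrow> y \<epsilon> i \<noteq> y \<epsilon> j) (at_right 0)"
    proof clarify
      fix i j
      show "eventually (\<lambda>\<epsilon>. i \<noteq> j \<longrightarrow> y \<epsilon> i \<noteq> y \<epsilon> j) (at_right 0)"
        using distinct[of i j] by (cases "i = j") simp_all
    qed
  qed simp
  moreover have "eventually (\<lambda>\<epsilon>::real. \<epsilon> > 0) (at_right 0)"
    by (rule eventually_at_right_less)
  ultimately have eq: "eventually (\<lambda>\<epsilon>. pfaffian N (\<lambda>i j. schur_ratio (y \<epsilon> i) (y \<epsilon> j)) = pair_prod schur_ratio (2 * N) (y \<epsilon>)) (at_right 0)"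
  proof eventually_elim
    case (elim \<epsilon>)
    have "inj_on (y \<epsilon>) {..<2 * N}"
      using elim(1) by (auto simp: inj_on_def)
    moreover have "y \<epsilon> i > 0" if "i < 2 * N" for i
      using nonneg[OF that] elim(2) by (auto simp: y_def intro!: add_nonneg_pos)
    ultimately show ?case
      using schur_pfaffian_positive[of "y \<epsilon>" N] by (simp add: pfaffian_def)
  qed
  have "((\<lambda>\<epsilon>. pfaffian N (\<lambda>i j. schur_ratio (y \<epsilon> i) (y \<epsilon> j))) \<longlongrightarrow> pfaffian N (\<lambda>i j. schur_ratio (x i) (x j))) (at_right 0)"
    unfolding pfaffian_def
  proof (intro tendsto_intros s_lim)
    fix p k assume p: "p \<in> {p. p permutes {..<2 * N}}" and k: "k \<in> {..<N}"
    then have p: "p permutes {..<2 * N}" by simp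
    show "p (2 * k) < 2 * N" "p (2 * k + 1) < 2 * N"
      using permutes_in_image[OF p, of "2 * k"] permutes_in_image[OF p, of "2 * k + 1"] k by auto
    \<comment> \<open>A permutation never pairs an index with itself, so only entries with
      nonvanishing limit denominator occur.\<close>
    show "p (2 * k) \<noteq> p (2 * k + 1)"
      using p by (auto simp: inj_eq permutes_inj)
  qed auto
  then have "((\<lambda>\<epsilon>. pair_prod schur_ratio (2 * N) (y \<epsilon>)) \<longlongrightarrow> pfaffian N (\<lambda>i j. schur_ratio (x i) (x j))) (at_right 0)"
    using eq by (rule Lim_transform_eventually)
  moreover have "((\<lambda>\<epsilon>. pair_prod schur_ratio (2 * N) (y \<epsilon>)) \<longlongrightarrow> pair_prod schur_ratio (2 * N) x) (at_right 0)"
    unfolding pair_prod_def by (intro tendsto_intros s_lim) auto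
  ultimately show ?thesis
    by (rule tendsto_unique[OF trivial_limit_at_right_real])
qed

section \<open>Integrals over finite product measures\<close>

context product_sigma_finite
begin

lemma integrable_prod_times_bounded:
  fixes g :: "'i \<Rightarrow> 'a \<Rightarrow> real"
  assumes I: "finite I" and g: "\<And>i. i \<in> I \<Longrightarrow> integrable (M i) (g i)"
    and c: "c \<in> borel_measurable (Pi\<^sub>M I M)" and B: "\<And>x. \<bar>c x\<bar> \<le> B"
  shows "integrable (Pi\<^sub>M I M) (\<lambda>x. (\<Prod>i\<in>I. g i (x i)) * c x)"
proof (rule Bochner_Integration.integrable_bound)
  show "integrable (Pi\<^sub>M I M) (\<lambda>x. B * (\<Prod>i\<in>I. g i (x i)))"
    using product_integrable_prod[OF I g] by simp
  show "(\<lambda>x. (\<Prod>i\<in>I. g i (x i)) * c x) \<in> borel_measurable (Pi\<^sub>M I M)"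
    using product_integrable_prod[OF I g] c by (intro borel_measurable_times) auto
  have "\<bar>c x\<bar> \<le> \<bar>B\<bar>" for x
    using B[of x] by simp
  then show "AE x in Pi\<^sub>M I M. norm ((\<Prod>i\<in>I. g i (x i)) * c x) \<le> norm (B * (\<Prod>i\<in>I. g i (x i)))"
    by (simp add: abs_mult mult.commute mult_right_mono)
qed

lemma measurable_two_components:
  assumes "(\<lambda>(u, v). s u v) \<in> borel_measurable (M i \<Otimes>\<^sub>M M j)" "i \<in> I" "j \<in> I"
  shows "(\<lambda>x. s (x i) (x j)) \<in> borel_measurable (Pi\<^sub>M I M)"
proof -
  have "(\<lambda>x. (x i, x j)) \<in> Pi\<^sub>M I M \<rightarrow>\<^sub>M M i \<Otimes>\<^sub>M M j"
    using assms(2,3) by simp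
  from measurable_compose[OF this assms(1)] show ?thesis by simp
qed

text \<open>The pairs partition the coordinates, so the integrand separates. The index set is an
  image under \<open>p\<close> because the induction removes the last pair, and the coordinates that
  remain are arbitrary ones rather than an initial segment.\<close>

lemma integral_prod_pairs:
  fixes g :: "'i \<Rightarrow> 'a \<Rightarrow> real" and N :: nat
  assumes "inj_on p {..<2 * N}"
    and "\<And>i. i \<in> p ` {..<2 * N} \<Longrightarrow> integrable (M i) (g i)"
    and s: "\<And>i j. (\<lambda>(u, v). s u v) \<in> borel_measurable (M i \<Otimes>\<^sub>M M j)"
    and s1: "\<And>u v. \<bar>s u v\<bar> \<le> 1"
  shows "(\<integral>x. (\<Prod>i\<in>p ` {..<2 * N}. g i (x i)) * (\<Prod>k<N. s (x (p (2 * k))) (x (p (2 * k + 1)))) \<partial>Pi\<^sub>M (p ` {..<2 * N}) M)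
    = (\<Prod>k<N. \<integral>u. (\<integral>v. g (p (2 * k)) u * g (p (2 * k + 1)) v * s u v \<partial>M (p (2 * k + 1))) \<partial>M (p (2 * k)))"
  using assms(1,2)
proof (induction N)
  case 0
  then show ?case
    by (simp add: PiM_empty)
next
  case (Suc N)
  define I where "I = p ` {..<2 * N}"
  define a where "a = p (2 * N)"
  define b where "b = p (2 * N + 1)"
  \<comment> \<open>Integrating out \<open>b\<close> leaves a bounded function of the coordinate
    \<open>a\<close>; its bound makes \<open>integrable_prod_times_bounded\<close> apply again when
    \<open>a\<close> is integrated out.\<close>
  define H where "H u = (\<integral>v. g b v * s u v \<partial>M b)" for u
  define S where "S x = (\<Prod>k<N. s (x (p (2 * k))) (x (p (2 * k + 1))))" for x
  have "{..<2 * Suc N} = insert (2 * N + 1) (insert (2 * N) {..<2 * N})" by auto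
  then have image: "p ` {..<2 * Suc N} = insert b (insert a I)"
    by (simp add: I_def a_def b_def)
  have finI: "finite I" by (simp add: I_def)
  have p_eq: "m = n" if "p m = p n" "m < 2 * Suc N" "n < 2 * Suc N" for m n
    using inj_onD[OF Suc.prems(1) that(1)] that by simp
  have aI: "a \<notin> I"
    using p_eq[of "2 * N"] by (force simp: I_def a_def)
  have ba: "b \<notin> insert a I"
    using p_eq[of "2 * N + 1"] by (force simp: I_def a_def b_def)
  have pI: "p (2 * k) \<in> I" "p (2 * k + 1) \<in> I" if "k < N" for k
    using that by (auto simp: I_def)
  have ga: "integrable (M a) (g a)" and gb: "integrable (M b) (g b)" and gI: "\<And>i. i \<in> I \<Longrightarrow> integrable (M i) (g i)"
    using Suc.prems(2) unfolding image by auto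
  have H_meas: "H \<in> borel_measurable (M a)"
    unfolding H_def
  proof (rule sigma_finite_measure.borel_measurable_lebesgue_integral[OF sigma_finite_measures])
    have "(\<lambda>z. g b (snd z)) \<in> borel_measurable (M a \<Otimes>\<^sub>M M b)"
      by (rule measurable_compose[OF measurable_snd borel_measurable_integrable[OF gb]])
    then show "(\<lambda>(u, v). g b v * s u v) \<in> borel_measurable (M a \<Otimes>\<^sub>M M b)"
      using s[of a b] by (simp add: case_prod_beta')
  qed
  have H_bound: "\<bar>H u\<bar> \<le> (\<integral>v. \<bar>g b v\<bar> \<partial>M b)" for u
  proof -
    have "\<bar>H u\<bar> \<le> (\<integral>v. \<bar>g b v * s u v\<bar> \<partial>M b)"
      unfolding H_def by (rule integral_abs_bound)
    also have "\<dots> \<le> (\<integral>v. \<bar>g b v\<bar> \<partial>M b)"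
      using gb s1 by (intro integral_mono') (auto simp: abs_mult mult_left_le)
    finally show ?thesis .
  qed
  have S_meas: "S \<in> borel_measurable (Pi\<^sub>M J M)" if "I \<subseteq> J" for J
    unfolding S_def using that pI by (intro borel_measurable_prod measurable_two_components[OF s]) auto
  have S_bound: "\<bar>S x\<bar> \<le> 1" for x
    unfolding S_def abs_prod using s1 by (intro prod_le_1) auto
  have S_upd: "S (x(i := u)) = S x" if "i \<notin> I" for x i u
    unfolding S_def using that pI by (intro prod.cong refl) (auto intro!: arg_cong2[of _ _ _ _ s])
  have prod_upd: "(\<Prod>j\<in>J. g j ((x(i := u)) j)) = (\<Prod>j\<in>J. g j (x j))" if "i \<notin> J" for J x i u
    using that by (intro prod.cong) auto
  have "(\<integral>x. (\<Prod>i\<in>p ` {..<2 * Suc N}. g i (x i)) * (\<Prod>k<Suc N. s (x (p (2 * k))) (x (p (2 * k + 1)))) \<partial>Pi\<^sub>M (p ` {..<2 * Suc N}) M)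
      = (\<integral>x. (\<Prod>i\<in>insert b (insert a I). g i (x i)) * (S x * s (x a) (x b)) \<partial>Pi\<^sub>M (insert b (insert a I)) M)"
    unfolding image by (simp add: S_def a_def b_def)
  also have "\<dots> = (\<integral>x. (\<integral>v. (\<Prod>i\<in>insert b (insert a I). g i ((x(b := v)) i)) * (S (x(b := v)) * s ((x(b := v)) a) ((x(b := v)) b)) \<partial>M b) \<partial>Pi\<^sub>M (insert a I) M)"
  proof (rule product_integral_insert[OF _ ba])
    show "integrable (Pi\<^sub>M (insert b (insert a I)) M) (\<lambda>x. (\<Prod>i\<in>insert b (insert a I). g i (x i)) * (S x * s (x a) (x b)))"
    proof (rule integrable_prod_times_bounded)
      show "(\<lambda>x. S x * s (x a) (x b)) \<in> borel_measurable (Pi\<^sub>M (insert b (insert a I)) M)"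
        by (intro borel_measurable_times S_meas measurable_two_components[OF s]) auto
      show "\<bar>S x * s (x a) (x b)\<bar> \<le> 1" for x
        using S_bound[of x] s1[of "x a" "x b"] by (simp add: abs_mult mult_le_one)
    qed (use finI ga gb gI in auto)
  qed (use finI in simp)
  also have "\<dots> = (\<integral>x. (\<Prod>i\<in>insert a I. g i (x i)) * (S x * H (x a)) \<partial>Pi\<^sub>M (insert a I) M)"
  proof (intro Bochner_Integration.integral_cong refl)
    fix x
    have "(\<Prod>i\<in>insert b (insert a I). g i ((x(b := v)) i)) * (S (x(b := v)) * s ((x(b := v)) a) ((x(b := v)) b))
        = ((\<Prod>i\<in>insert a I. g i (x i)) * S x) * (g b v * s (x a) v)" for v
      using ba finI S_upd[of b x v] prod_upd[OF ba, of x v] by (auto simp: fun_upd_def)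
    then show "(\<integral>v. (\<Prod>i\<in>insert b (insert a I). g i ((x(b := v)) i)) * (S (x(b := v)) * s ((x(b := v)) a) ((x(b := v)) b)) \<partial>M b)
      = (\<Prod>i\<in>insert a I. g i (x i)) * (S x * H (x a))"
      by (simp add: H_def mult.assoc)
  qed
  also have "\<dots> = (\<integral>x. (\<integral>u. (\<Prod>i\<in>insert a I. g i ((x(a := u)) i)) * (S (x(a := u)) * H ((x(a := u)) a)) \<partial>M a) \<partial>Pi\<^sub>M I M)"
  proof (rule product_integral_insert[OF finI aI])
    show "integrable (Pi\<^sub>M (insert a I) M) (\<lambda>x. (\<Prod>i\<in>insert a I. g i (x i)) * (S x * H (x a)))"
    proof (rule integrable_prod_times_bounded)
      show "(\<lambda>x. S x * H (x a)) \<in> borel_measurable (Pi\<^sub>M (insert a I) M)"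
        by (intro borel_measurable_times S_meas measurable_compose[OF _ H_meas] measurable_component_singleton) auto
      show "\<bar>S x * H (x a)\<bar> \<le> 1 * (\<integral>v. \<bar>g b v\<bar> \<partial>M b)" for x
        unfolding abs_mult using S_bound[of x] H_bound[of "x a"] by (intro mult_mono) auto
    qed (use finI ga gI in auto)
  qed
  also have "\<dots> = (\<integral>x. ((\<Prod>i\<in>I. g i (x i)) * S x) * (\<integral>u. g a u * H u \<partial>M a) \<partial>Pi\<^sub>M I M)"
  proof (intro Bochner_Integration.integral_cong refl)
    fix x
    have "(\<Prod>i\<in>insert a I. g i ((x(a := u)) i)) * (S (x(a := u)) * H ((x(a := u)) a))
        = ((\<Prod>i\<in>I. g i (x i)) * S x) * (g a u * H u)" for u
      using aI finI S_upd[of a x u] prod_upd[OF aI, of x u] by (simp add: fun_upd_def)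
    then show "(\<integral>u. (\<Prod>i\<in>insert a I. g i ((x(a := u)) i)) * (S (x(a := u)) * H ((x(a := u)) a)) \<partial>M a)
      = ((\<Prod>i\<in>I. g i (x i)) * S x) * (\<integral>u. g a u * H u \<partial>M a)"
      by (simp only: integral_mult_right_zero)
  qed
  also have "\<dots> = (\<integral>x. (\<Prod>i\<in>I. g i (x i)) * S x \<partial>Pi\<^sub>M I M) * (\<integral>u. g a u * H u \<partial>M a)"
    by simp
  also have "(\<integral>x. (\<Prod>i\<in>I. g i (x i)) * S x \<partial>Pi\<^sub>M I M)
    = (\<Prod>k<N. \<integral>u. (\<integral>v. g (p (2 * k)) u * g (p (2 * k + 1)) v * s u v \<partial>M (p (2 * k + 1))) \<partial>M (p (2 * k)))"
    unfolding I_def S_def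
    using Suc.prems by (intro Suc.IH) (auto intro: inj_on_subset)
  also have "(\<integral>u. g a u * H u \<partial>M a) = (\<integral>u. (\<integral>v. g a u * g b v * s u v \<partial>M b) \<partial>M a)"
    by (simp add: H_def mult.assoc)
  finally show ?case
    by (simp add: a_def b_def)
qed

end

text \<open>Both measures agree on boxes, since the preimage of a box is the box with renamed sides.
  It serves for permuting coordinates and for the index shift by \<open>Suc\<close>.\<close>

lemma (in product_sigma_finite) distr_PiM_reindex_bij:
  assumes J: "finite J" and f: "bij_betw f J I"
  shows "distr (Pi\<^sub>M I M) (Pi\<^sub>M J (\<lambda>j. M (f j))) (\<lambda>x. \<lambda>j\<in>J. x (f j)) = Pi\<^sub>M J (\<lambda>j. M (f j))"
proof -
  interpret J: product_sigma_finite "\<lambda>j. M (f j)"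
    unfolding product_sigma_finite_def using sigma_finite_measures by blast
  have fI: "f j \<in> I" if "j \<in> J" for j
    using f that by (rule bij_betw_apply)
  have finI: "finite I"
    using J f by (simp add: bij_betw_finite)
  have meas: "(\<lambda>x. \<lambda>j\<in>J. x (f j)) \<in> Pi\<^sub>M I M \<rightarrow>\<^sub>M Pi\<^sub>M J (\<lambda>j. M (f j))"
    using fI by (intro measurable_restrict measurable_component_singleton)
  show ?thesis
  proof (rule J.PiM_eqI[OF J])
    fix A assume A: "\<And>j. j \<in> J \<Longrightarrow> A j \<in> sets (M (f j))"
    define g where "g = the_inv_into J f"
    have gf: "g (f j) = j" if "j \<in> J" for j
      using that f by (simp add: g_def bij_betw_def the_inv_into_f_f)
    have g: "g i \<in> J" "f (g i) = i" if "i \<in> I" for i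
      using that f unfolding bij_betw_def g_def
      by (auto intro: the_inv_into_into f_the_inv_into_f)
    have "(\<lambda>x. \<lambda>j\<in>J. x (f j)) -` (Pi\<^sub>E J A) \<inter> space (Pi\<^sub>M I M) = Pi\<^sub>E I (\<lambda>i. A (g i))"
    proof (intro set_eqI iffI)
      fix x assume "x \<in> (\<lambda>x. \<lambda>j\<in>J. x (f j)) -` (Pi\<^sub>E J A) \<inter> space (Pi\<^sub>M I M)"
      then have x: "(\<lambda>j\<in>J. x (f j)) \<in> Pi\<^sub>E J A" "x \<in> Pi\<^sub>E I (\<lambda>i. space (M i))"
        by (simp_all add: space_PiM)
      have "x i \<in> A (g i)" if "i \<in> I" for i
        using PiE_mem[OF x(1) g(1)[OF that]] g[OF that] by simp
      with x(2) show "x \<in> Pi\<^sub>E I (\<lambda>i. A (g i))"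
        by (simp add: PiE_iff)
    next
      fix x assume x: "x \<in> Pi\<^sub>E I (\<lambda>i. A (g i))"
      have "x i \<in> space (M i)" if "i \<in> I" for i
        using x that g[OF that] sets.sets_into_space[OF A[OF g(1)[OF that]]] by (auto simp: PiE_iff)
      moreover have "x (f j) \<in> A j" if "j \<in> J" for j
        using x fI[OF that] gf[OF that] by (metis PiE_mem)
      ultimately show "x \<in> (\<lambda>x. \<lambda>j\<in>J. x (f j)) -` (Pi\<^sub>E J A) \<inter> space (Pi\<^sub>M I M)"
        using x by (simp add: PiE_iff space_PiM)
    qed
    then have "emeasure (distr (Pi\<^sub>M I M) (Pi\<^sub>M J (\<lambda>j. M (f j))) (\<lambda>x. \<lambda>j\<in>J. x (f j))) (Pi\<^sub>E J A)
        = emeasure (Pi\<^sub>M I M) (Pi\<^sub>E I (\<lambda>i. A (g i)))"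
      using A J by (subst emeasure_distr[OF meas]) (auto intro!: sets_PiM_I_finite)
    also have "\<dots> = (\<Prod>i\<in>I. emeasure (M i) (A (g i)))"
      using A g by (intro emeasure_PiM finI) metis
    also have "\<dots> = (\<Prod>j\<in>J. emeasure (M (f j)) (A j))"
      using gf by (simp add: prod.reindex_bij_betw[OF f, symmetric])
    finally show "emeasure (distr (Pi\<^sub>M I M) (Pi\<^sub>M J (\<lambda>j. M (f j))) (\<lambda>x. \<lambda>j\<in>J. x (f j))) (Pi\<^sub>E J A)
        = (\<Prod>j\<in>J. emeasure (M (f j)) (A j))" .
  qed simp
qed

text \<open>Every term of the Pfaffian uses each row once, so all terms share the product of the
  \<open>g i\<close> and can be collected under one integral. The measure may vary with the row,
  which admits a point mass in one row; the entries are prescribed off the diagonal, where all pairs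
  of a permutation lie.\<close>

lemma pfaffian_of_integrals:
  fixes M :: "nat \<Rightarrow> 'a measure" and g :: "nat \<Rightarrow> 'a \<Rightarrow> real"
  assumes M: "product_sigma_finite M"
    and g: "\<And>i. i < 2 * N \<Longrightarrow> integrable (M i) (g i)"
    and s: "\<And>i j. (\<lambda>(u, v). s u v) \<in> borel_measurable (M i \<Otimes>\<^sub>M M j)"
    and s1: "\<And>u v. \<bar>s u v\<bar> \<le> 1"
    and A: "\<And>i j. i < 2 * N \<Longrightarrow> j < 2 * N \<Longrightarrow> i \<noteq> j \<Longrightarrow>
      A i j = (\<integral>u. (\<integral>v. g i u * g j v * s u v \<partial>M j) \<partial>M i)"
  shows "integrable (Pi\<^sub>M {..<2 * N} M) (\<lambda>x. (\<Prod>i<2 * N. g i (x i)) * pfaffian N (\<lambda>i j. s (x i) (x j)))"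
    and "pfaffian N A =
      (\<integral>x. (\<Prod>i<2 * N. g i (x i)) * pfaffian N (\<lambda>i j. s (x i) (x j)) \<partial>Pi\<^sub>M {..<2 * N} M)"
proof -
  interpret product_sigma_finite M by (rule M)
  define F where "F p x = (\<Prod>i<2 * N. g i (x i)) * (\<Prod>k<N. s (x (p (2 * k))) (x (p (2 * k + 1))))" for p x
  have less: "p (2 * k) < 2 * N" "p (2 * k + 1) < 2 * N" if p: "p permutes {..<2 * N}" and k: "k < N" for p k
    using permutes_in_image[OF p, of "2 * k"] permutes_in_image[OF p, of "2 * k + 1"] k by auto
  have F_int: "integrable (Pi\<^sub>M {..<2 * N} M) (F p)" if p: "p permutes {..<2 * N}" for p
    unfolding F_def
  proof (rule integrable_prod_times_bounded)
    show "(\<lambda>x. \<Prod>k<N. s (x (p (2 * k))) (x (p (2 * k + 1)))) \<in> borel_measurable (Pi\<^sub>M {..<2 * N} M)"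
      using less[OF p] by (intro borel_measurable_prod measurable_two_components[OF s]) auto
    show "\<bar>\<Prod>k<N. s (x (p (2 * k))) (x (p (2 * k + 1)))\<bar> \<le> 1" for x
      unfolding abs_prod using s1 by (intro prod_le_1) auto
  qed (use g in auto)
  have F_sum: "(\<Prod>i<2 * N. g i (x i)) * pfaffian N (\<lambda>i j. s (x i) (x j))
      = (\<Sum>p | p permutes {..<2 * N}. of_int (sign p) * F p x) / (2 ^ N * fact N)" for x
    by (simp add: pfaffian_def F_def sum_distrib_left mult_ac)
  show "integrable (Pi\<^sub>M {..<2 * N} M) (\<lambda>x. (\<Prod>i<2 * N. g i (x i)) * pfaffian N (\<lambda>i j. s (x i) (x j)))"
    unfolding F_sum using F_int
    by (intro Bochner_Integration.integrable_divide Bochner_Integration.integrable_sum integrable_mult_right) auto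
  have "(\<Prod>k<N. A (p (2 * k)) (p (2 * k + 1))) = integral\<^sup>L (Pi\<^sub>M {..<2 * N} M) (F p)"
    if p: "p permutes {..<2 * N}" for p
  proof -
    have "(\<Prod>k<N. A (p (2 * k)) (p (2 * k + 1)))
        = (\<Prod>k<N. \<integral>u. (\<integral>v. g (p (2 * k)) u * g (p (2 * k + 1)) v * s u v \<partial>M (p (2 * k + 1))) \<partial>M (p (2 * k)))"
      using less[OF p] p by (intro prod.cong refl A) (auto simp: inj_eq permutes_inj)
    also have "\<dots> = integral\<^sup>L (Pi\<^sub>M {..<2 * N} M) (F p)"
      using integral_prod_pairs[of p N g s] g s s1 permutes_inj_on[OF p]
      by (simp add: permutes_image[OF p] F_def[abs_def])
    finally show ?thesis .
  qed
  then have "pfaffian N A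
      = (\<Sum>p | p permutes {..<2 * N}. of_int (sign p) * integral\<^sup>L (Pi\<^sub>M {..<2 * N} M) (F p)) / (2 ^ N * fact N)"
    by (simp add: pfaffian_def)
  also have "\<dots> = (\<integral>x. (\<Sum>p | p permutes {..<2 * N}. of_int (sign p) * F p x) / (2 ^ N * fact N) \<partial>Pi\<^sub>M {..<2 * N} M)"
    using F_int by (simp add: Bochner_Integration.integral_sum)
  finally show "pfaffian N A =
      (\<integral>x. (\<Prod>i<2 * N. g i (x i)) * pfaffian N (\<lambda>i j. s (x i) (x j)) \<partial>Pi\<^sub>M {..<2 * N} M)"
    by (simp only: F_sum)
qed

section \<open>Decomposition into ordered chambers\<close>

lemma lborel_product_sigma_finite: "product_sigma_finite (\<lambda>_. lborel :: real measure)"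
  unfolding product_sigma_finite_def using sigma_finite_lborel by blast

text \<open>Integrate over coordinate \<open>i\<close> first: for fixed remaining coordinates the
  exceptional set is at most one point.\<close>

lemma AE_PiM_lborel_neq:
  fixes I :: "nat set"
  assumes "finite I" "i \<in> I" "j \<in> I" "i \<noteq> j"
  shows "AE x in Pi\<^sub>M I (\<lambda>_. lborel :: real measure). x i \<noteq> x j"
proof -
  interpret product_sigma_finite "\<lambda>_ :: nat. lborel :: real measure"
    by (rule lborel_product_sigma_finite)
  define J where "J = I - {i}"
  have I: "I = insert i J" "finite J" "i \<notin> J" "j \<in> J"
    using assms by (auto simp: J_def)
  let ?N = "{x \<in> space (Pi\<^sub>M I (\<lambda>_. lborel :: real measure)). x i = x j}"
  have N: "?N \<in> sets (Pi\<^sub>M I (\<lambda>_. lborel))"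
    using assms(2,3) measurable_component_singleton[of _ I "\<lambda>_. lborel :: real measure"]
    by (intro borel_measurable_eq) simp_all
  have "emeasure (Pi\<^sub>M I (\<lambda>_. lborel)) ?N = (\<integral>\<^sup>+x. indicator ?N x \<partial>Pi\<^sub>M I (\<lambda>_. lborel))"
    using N by simp
  also have "\<dots> = (\<integral>\<^sup>+x. (\<integral>\<^sup>+y. indicator ?N (x(i := y)) \<partial>lborel) \<partial>Pi\<^sub>M J (\<lambda>_. lborel))"
    unfolding I(1) using I N by (intro product_nn_integral_insert) auto
  also have "\<dots> = (\<integral>\<^sup>+x. 0 \<partial>Pi\<^sub>M J (\<lambda>_. lborel :: real measure))"
  proof (intro nn_integral_cong)
    fix x :: "nat \<Rightarrow> real"
    have "(\<integral>\<^sup>+y. indicator ?N (x(i := y)) \<partial>lborel) \<le> (\<integral>\<^sup>+y. indicator {x j} y \<partial>lborel)"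
      using assms by (intro nn_integral_mono) (auto simp: indicator_def)
    then show "(\<integral>\<^sup>+y. indicator ?N (x(i := y)) \<partial>lborel) = 0"
      by simp
  qed
  finally have "emeasure (Pi\<^sub>M I (\<lambda>_. lborel)) ?N = 0" by simp
  with N have "?N \<in> null_sets (Pi\<^sub>M I (\<lambda>_. lborel))" by blast
  then show ?thesis
    by (rule AE_I') auto
qed

text \<open>The chamber leaves the values at indices from \<open>n\<close> on free, so it is not a
  subset of the space of the product measure; therefore its indicator function is treated instead of
  the set.\<close>

lemma ordered_chamber_measurable:
  "(indicator (ordered_chamber n) :: _ \<Rightarrow> real) \<in> borel_measurable (Pi\<^sub>M {..<n} (\<lambda>_. lborel))"
proof -
  have "indicator (ordered_chamber n) x =
      (\<Prod>i<n. indicator {0<..} (x i)) * (\<Prod>j<n. \<Prod>i<j. indicator {0<..} (x j - x i) :: real)" for x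
    by (auto simp: ordered_chamber_def indicator_def prod_zero_iff)
  moreover have "(\<lambda>x. indicator {0<..} (h x) :: real) \<in> borel_measurable (Pi\<^sub>M {..<n} (\<lambda>_. lborel))"
    if "h \<in> borel_measurable (Pi\<^sub>M {..<n} (\<lambda>_. lborel))" for h :: "_ \<Rightarrow> real"
    using that by (rule measurable_compose) simp
  moreover have "(\<lambda>x. x i) \<in> borel_measurable (Pi\<^sub>M {..<n} (\<lambda>_. lborel :: real measure))" if "i < n" for i
    using measurable_component_singleton[of i "{..<n}" "\<lambda>_. lborel :: real measure"] that by simp
  ultimately show ?thesis
    by (subst measurable_cong) (auto intro!: borel_measurable_times borel_measurable_prod borel_measurable_diff)
qed

text \<open>The sorting permutation of distinct reals is the inverse of the rank function.\<close>
lemma ex1_sorting_permutation: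
  fixes x :: "nat \<Rightarrow> real"
  assumes inj: "inj_on x {..<n}"
  shows "\<exists>!q. q permutes {..<n} \<and> (\<forall>i j. i < j \<and> j < n \<longrightarrow> x (q i) < x (q j))"
proof -
  \<comment> \<open>Outside the range \<open>r\<close> is the identity, as \<open>permutes\<close>
    demands.\<close>
  define r where "r k = (if k < n then card {j. j < n \<and> x j < x k} else k)" for k
  have r_mono: "r k < r l \<longleftrightarrow> x k < x l" if "k < n" "l < n" for k l
  proof -
    have less: "r k < r l" if "k < n" "l < n" "x k < x l" for k l
    proof -
      have "{j. j < n \<and> x j < x k} \<subset> {j. j < n \<and> x j < x l}"
        using that by auto
      then show ?thesis
        using that by (simp add: r_def psubset_card_mono)
    qed
    show ?thesis
      using less[of k l] less[of l k] that inj by (metis inj_onD lessThan_iff less_asym linorder_less_linear)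
  qed
  have r_less: "r k < n" if "k < n" for k
  proof -
    have "{j. j < n \<and> x j < x k} \<subset> {..<n}" using that by auto
    then have "card {j. j < n \<and> x j < x k} < card {..<n}"
      by (intro psubset_card_mono) auto
    then show ?thesis using that by (simp add: r_def)
  qed
  have r_perm: "r permutes {..<n}"
  proof (rule bij_imp_permutes)
    have "inj_on r {..<n}"
      using inj r_mono by (intro inj_onI) (metis inj_onD lessThan_iff less_irrefl linorder_less_linear)
    moreover have "r ` {..<n} \<subseteq> {..<n}"
      using r_less by auto
    ultimately show "bij_betw r {..<n} {..<n}"
      by (simp add: bij_betw_def endo_inj_surj)
  qed (simp add: r_def)
  show ?thesis
  proof (rule ex1I[of _ "inv r"], intro conjI allI impI)
    show "inv r permutes {..<n}"
      using r_perm by (rule permutes_inv)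
    fix i j assume ij: "i < j \<and> j < n"
    have "inv r i < n" "inv r j < n"
      using ij permutes_in_image[OF permutes_inv[OF r_perm]] by (metis lessThan_iff order.strict_trans)+
    then show "x (inv r i) < x (inv r j)"
      using r_mono[of "inv r i" "inv r j"] ij permutes_inverses[OF r_perm] by simp
  next
    fix q assume q: "q permutes {..<n} \<and> (\<forall>i j. i < j \<and> j < n \<longrightarrow> x (q i) < x (q j))"
    have "r (q i) = i" for i
    proof (cases "i < n")
      case True
      have q_less: "q k < n \<longleftrightarrow> k < n" for k
        using q permutes_in_image[of q "{..<n}" k] by simp
      have iff: "x (q k) < x (q i) \<longleftrightarrow> k < i" if "k < n" for k
        using q that True by (metis less_asym linorder_less_linear less_irrefl)
      \<comment> \<open>For a sorting \<open>q\<close>, the entries below x (q i) are those placed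
        at the \<open>i\<close> earlier positions, so the rank of \<open>q i\<close> is
        \<open>i\<close>.\<close>
      have "{j. j < n \<and> x j < x (q i)} = q ` {..<i}"
      proof (intro set_eqI iffI)
        fix j assume "j \<in> {j. j < n \<and> x j < x (q i)}"
        moreover obtain k where "j = q k"
          using q by (metis permutes_surj surjD)
        ultimately show "j \<in> q ` {..<i}"
          using q_less iff by auto
      next
        fix j assume "j \<in> q ` {..<i}"
        then show "j \<in> {j. j < n \<and> x j < x (q i)}"
          using q_less iff True by auto
      qed
      moreover have "card (q ` {..<i}) = i"
        using q card_image[OF permutes_inj_on] by fastforce
      ultimately show ?thesis
        using True q_less by (simp add: r_def)
    next
      case False
      then have "q i = i"
        using q permutes_not_in[of q "{..<n}" i] by simp
      then show ?thesis
        using False by (simp add: r_def)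
    qed
    then show "q = inv r"
      using r_perm by (metis ext permutes_inverses(2))
  qed
qed

section \<open>Permuting coordinates under the integral\<close>

lemma integral_PiM_permute:
  fixes f :: "(nat \<Rightarrow> real) \<Rightarrow> real"
  assumes q: "q permutes {..<n}" and f: "f \<in> borel_measurable (Pi\<^sub>M {..<n} (\<lambda>_. lborel))"
  shows "(\<integral>x. f (\<lambda>i\<in>{..<n}. x (q i)) \<partial>Pi\<^sub>M {..<n} (\<lambda>_. lborel))
    = (\<integral>x. f x \<partial>Pi\<^sub>M {..<n} (\<lambda>_. lborel))"
proof -
  interpret product_sigma_finite "\<lambda>_ :: nat. lborel :: real measure"
    by (rule lborel_product_sigma_finite)
  have "(\<lambda>x. \<lambda>i\<in>{..<n}. x (q i)) \<in> Pi\<^sub>M {..<n} (\<lambda>_. lborel :: real measure) \<rightarrow>\<^sub>M Pi\<^sub>M {..<n} (\<lambda>_. lborel)"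
    using permutes_in_image[OF q] by (intro measurable_restrict measurable_component_singleton) simp
  from integral_distr[OF this f] show ?thesis
    using distr_PiM_reindex_bij[OF _ permutes_imp_bij[OF q]] by simp
qed

text \<open>Almost every point has distinct coordinates. If all are positive, exactly one reordering
  lies in the chamber; otherwise \<open>f\<close> vanishes by \<open>f0\<close>. Hence
  \<open>f\<close> is almost everywhere the sum of its products with the indicators of the reordered
  points, and a change of variables in each term moves the permutation from the indicator to
  \<open>f\<close>.\<close>

lemma integral_eq_integral_ordered_chamber:
  fixes f :: "(nat \<Rightarrow> real) \<Rightarrow> real"
  assumes f: "integrable (Pi\<^sub>M {..<n} (\<lambda>_. lborel)) f"
    and f0: "\<And>x i. i < n \<Longrightarrow> x i \<le> 0 \<Longrightarrow> f x = 0"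
  shows "(\<integral>x. f x \<partial>Pi\<^sub>M {..<n} (\<lambda>_. lborel)) =
    (LINT x:ordered_chamber n|Pi\<^sub>M {..<n} (\<lambda>_. lborel). \<Sum>q | q permutes {..<n}. f (\<lambda>i\<in>{..<n}. x (q i)))"
proof -
  let ?P = "Pi\<^sub>M {..<n} (\<lambda>_. lborel :: real measure)"
  let ?C = "indicator (ordered_chamber n) :: _ \<Rightarrow> real"
  \<comment> \<open>The restriction keeps the reordered point in the extensional space of the
    product measure.\<close>
  define R where "R q x = (\<lambda>i\<in>{..<n}. x (q i) :: real)" for q :: "nat \<Rightarrow> nat" and x
  have R_meas: "R q \<in> ?P \<rightarrow>\<^sub>M ?P" if "q permutes {..<n}" for q
    unfolding R_def[abs_def] using permutes_in_image[OF that]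
    by (intro measurable_restrict measurable_component_singleton) simp
  have CR_meas: "(\<lambda>x. ?C (R q x)) \<in> borel_measurable ?P" if "q permutes {..<n}" for q
    by (rule measurable_compose[OF R_meas[OF that] ordered_chamber_measurable])
  have fR_meas: "(\<lambda>x. f (R q x)) \<in> borel_measurable ?P" if "q permutes {..<n}" for q
    by (rule measurable_compose[OF R_meas[OF that] borel_measurable_integrable[OF f]])
  have Cf_int: "integrable ?P (\<lambda>x. ?C (R q x) * f x)" if "q permutes {..<n}" for q
  proof (rule Bochner_Integration.integrable_bound[OF f])
    show "(\<lambda>x. ?C (R q x) * f x) \<in> borel_measurable ?P"
      using CR_meas[OF that] f by (intro borel_measurable_times) auto
    show "AE x in ?P. norm (?C (R q x) * f x) \<le> norm (f x)"
      by (auto simp: indicator_def)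
  qed
  have R_inv: "R (inv q) (R q x) = x" if "q permutes {..<n}" "x \<in> space ?P" for q x
    using that permutes_in_image[OF permutes_inv[OF that(1)]] permutes_inverses[OF that(1)]
    by (auto simp: R_def space_PiM fun_eq_iff PiE_iff extensional_def)
  have swap: "(\<integral>x. ?C (R q x) * f x \<partial>?P) = (\<integral>x. ?C x * f (R (inv q) x) \<partial>?P)" if q: "q permutes {..<n}" for q
  proof -
    have "(\<integral>x. ?C (R q x) * f x \<partial>?P) = (\<integral>x. ?C (R q x) * f (R (inv q) (R q x)) \<partial>?P)"
      by (intro Bochner_Integration.integral_cong refl) (simp only: R_inv[OF q])
    also have "\<dots> = (\<integral>x. ?C x * f (R (inv q) x) \<partial>?P)"
      unfolding R_def[of q]
      using fR_meas[OF permutes_inv[OF q]] ordered_chamber_measurable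
      by (intro integral_PiM_permute[OF q, of "\<lambda>x. ?C x * f (R (inv q) x)"] borel_measurable_times)
    finally show ?thesis .
  qed
  have Cf_int': "integrable ?P (\<lambda>x. ?C x * f (R q x))" if q: "q permutes {..<n}" for q
  proof -
    interpret product_sigma_finite "\<lambda>_ :: nat. lborel :: real measure"
      by (rule lborel_product_sigma_finite)
    have "integrable (distr ?P ?P (R q)) f"
      using distr_PiM_reindex_bij[OF _ permutes_imp_bij[OF q]] f by (simp add: R_def[abs_def])
    then have int: "integrable ?P (\<lambda>x. f (R q x))"
      by (rule integrable_distr[OF R_meas[OF q]])
    show ?thesis
    proof (rule Bochner_Integration.integrable_bound[OF int])
      show "(\<lambda>x. ?C x * f (R q x)) \<in> borel_measurable ?P"
        using fR_meas[OF q] ordered_chamber_measurable by (intro borel_measurable_times)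
      show "AE x in ?P. norm (?C x * f (R q x)) \<le> norm (f (R q x))"
        by (auto simp: indicator_def)
    qed
  qed
  have "AE x in ?P. \<forall>i\<in>{..<n}. \<forall>j\<in>{..<n}. i \<noteq> j \<longrightarrow> x i \<noteq> x j"
  proof (rule AE_finite_allI, simp, rule AE_finite_allI, simp)
    fix i j assume "i \<in> {..<n}" "j \<in> {..<n}"
    then show "AE x in ?P. i \<noteq> j \<longrightarrow> x i \<noteq> x j"
      using AE_PiM_lborel_neq[of "{..<n}" i j] by (cases "i = j") simp_all
  qed
  then have "AE x in ?P. f x = (\<Sum>q | q permutes {..<n}. ?C (R q x) * f x)"
  proof eventually_elim
    case (elim x)
    show ?case
    proof (cases "\<forall>i<n. 0 < x i")
      case False
      then obtain i where "i < n" "x i \<le> 0" by (meson not_less)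
      then show ?thesis using f0 by simp
    next
      case True
      have "inj_on x {..<n}" using elim by (auto simp: inj_on_def)
      define S where "S p \<longleftrightarrow> (\<forall>i j. i < j \<and> j < n \<longrightarrow> x (p i) < x (p j))" for p
      from ex1_sorting_permutation[OF \<open>inj_on x {..<n}\<close>, folded S_def] obtain q where
        q: "q permutes {..<n} \<and> S q" and unique: "\<forall>p. p permutes {..<n} \<and> S p \<longrightarrow> p = q"
        by (rule ex1E)
      have "R p x \<in> ordered_chamber n \<longleftrightarrow> S p" if p: "p permutes {..<n}" for p
      proof -
        have R: "R p x i = x (p i)" if "i < n" for i
          using that by (simp add: R_def)
        have "0 < R p x i" if "i < n" for i
          unfolding R[OF that] using True permutes_in_image[OF p, of i] that by blast
        then show ?thesis
          unfolding ordered_chamber_def S_def mem_Collect_eq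
          by (intro iffI conjI allI impI) (use R in force)+
      qed
      then have "?C (R p x) = (if p = q then 1 else 0)" if "p permutes {..<n}" for p
        using that q unique by (metis indicator_simps)
      then have "(\<Sum>p | p permutes {..<n}. ?C (R p x) * f x) = (\<Sum>p | p permutes {..<n}. if p = q then f x else 0)"
        by (intro sum.cong) auto
      also have "\<dots> = f x"
        using q by (simp add: finite_permutations)
      finally show ?thesis by simp
    qed
  qed
  then have "(\<integral>x. f x \<partial>?P) = (\<integral>x. (\<Sum>q | q permutes {..<n}. ?C (R q x) * f x) \<partial>?P)"
    using f Cf_int by (intro integral_cong_AE) (auto intro!: borel_measurable_sum borel_measurable_integrable)
  also have "\<dots> = (\<Sum>q | q permutes {..<n}. \<integral>x. ?C x * f (R (inv q) x) \<partial>?P)"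
    using Cf_int swap by (simp add: Bochner_Integration.integral_sum)
  \<comment> \<open>The change of variables produced inverses; summing over the whole group absorbs
    them.\<close>
  also have "\<dots> = (\<Sum>q | q permutes {..<n}. \<integral>x. ?C x * f (R q x) \<partial>?P)"
    by (rule sum_permutations_inverse[symmetric])
  also have "\<dots> = (\<integral>x. (\<Sum>q | q permutes {..<n}. ?C x * f (R q x)) \<partial>?P)"
    using Cf_int' by (simp add: Bochner_Integration.integral_sum)
  finally show ?thesis
    by (simp add: set_lebesgue_integral_def R_def sum_distrib_left)
qed

section \<open>The tau function\<close>

text \<open>Absolute values leave the positive quadrant unchanged and make the kernel bounded on the whole plane.\<close>
definition abs_ratio :: "real \<Rightarrow> real \<Rightarrow> real" where
  "abs_ratio u v = schur_ratio \<bar>u\<bar> \<bar>v\<bar>"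

lemma abs_ratio_antisym: "abs_ratio v u = - abs_ratio u v"
  unfolding abs_ratio_def by (rule schur_ratio_antisym)

lemma abs_ratio_bounded: "\<bar>abs_ratio u v\<bar> \<le> 1"
proof (cases "\<bar>u\<bar> + \<bar>v\<bar> = 0")
  case False
  then have "0 < \<bar>u\<bar> + \<bar>v\<bar>" by simp
  then show ?thesis
    by (simp add: abs_ratio_def schur_ratio_def abs_divide divide_le_eq)
next
  \<comment> \<open>At the origin the ratio is 0 / 0, which has the value 0.\<close>
  case True
  then have "u = 0" "v = 0" by auto
  then show ?thesis by (simp add: abs_ratio_def schur_ratio_def)
qed

lemma abs_ratio_measurable:
  assumes "f \<in> borel_measurable N" "g \<in> borel_measurable N"
  shows "(\<lambda>x. abs_ratio (f x) (g x)) \<in> borel_measurable N"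
  unfolding abs_ratio_def schur_ratio_def using assms by simp

text \<open>Splits off the first variable instead of the last, because the row \<open>D0\<close>
  stands in front.\<close>

lemma pair_prod_shift:
  "pair_prod h (Suc n) x = (\<Prod>j<n. h (x 0) (x (Suc j))) * pair_prod h n (x \<circ> Suc)"
proof (induction n)
  case (Suc n)
  have last: "(\<Prod>i<Suc n. h (x i) (x (Suc n))) = h (x 0) (x (Suc n)) * (\<Prod>i<n. h (x (Suc i)) (x (Suc n)))"
    by (rule prod.lessThan_Suc_shift)
  show ?case
    unfolding pair_prod_Suc[of h "Suc n" x] Suc.IH last by (simp add: pair_prod_Suc o_def mult_ac)
qed (simp add: pair_prod_Suc)

lemma vandermonde_times_schur_product:
  "pair_prod (\<lambda>u v. v - u) n x * pair_prod schur_ratio n x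
    = (-1) ^ (n div 2) * (\<Prod>j<n. \<Prod>i<j. (x j - x i)\<^sup>2 / (x i + x j))"
proof (induction n)
  case (Suc n)
  \<comment> \<open>The new variable forms \<open>n\<close> pairs with the old ones, and (n + 1) div
    2 exceeds n div 2 exactly when \<open>n\<close> is odd.\<close>
  have sign: "(-1) ^ (Suc n div 2) = (-1) ^ (n div 2) * (-1 :: real) ^ n"
    by (cases "even n") (auto elim!: evenE oddE)
  have "(\<Prod>i<n. x n - x i) * (\<Prod>i<n. schur_ratio (x i) (x n)) = (\<Prod>i<n. (-1) * ((x n - x i)\<^sup>2 / (x i + x n)))"
    unfolding prod.distrib[symmetric] by (intro prod.cong refl) (simp add: schur_ratio_def power2_eq_square algebra_simps flip: diff_divide_distrib add_divide_distrib)
  also have "\<dots> = (-1) ^ n * (\<Prod>i<n. (x n - x i)\<^sup>2 / (x i + x n))"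
    unfolding prod.distrib by simp
  finally have step: "(\<Prod>i<n. x n - x i) * (\<Prod>i<n. schur_ratio (x i) (x n)) = (-1) ^ n * (\<Prod>i<n. (x n - x i)\<^sup>2 / (x i + x n))" .
  have "(a * b) * (c * d) = e * f * (g * h)" if "a * c = e * g" "b * d = f * h" for a b c d e f g h :: real
    using that by algebra
  from this[OF Suc.IH step] show ?case
    unfolding pair_prod_Suc sign prod.lessThan_Suc .
qed simp

section \<open>Moments as integrals over the whole line\<close>

lemma integrable_pair_bounded:
  fixes f g :: "real \<Rightarrow> real"
  assumes f: "integrable lborel f" and g: "integrable lborel g"
    and c: "(\<lambda>(u, v). c u v) \<in> borel_measurable (lborel \<Otimes>\<^sub>M lborel)" and c1: "\<And>u v. \<bar>c u v\<bar> \<le> 1"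
  shows "integrable (lborel \<Otimes>\<^sub>M lborel) (\<lambda>(u, v). f u * g v * c u v)"
proof (rule Bochner_Integration.integrable_bound)
  have fm: "(\<lambda>z. f (fst z)) \<in> borel_measurable (lborel \<Otimes>\<^sub>M lborel)"
    and gm: "(\<lambda>z. g (snd z)) \<in> borel_measurable (lborel \<Otimes>\<^sub>M lborel)"
    by (rule measurable_compose[OF measurable_fst borel_measurable_integrable[OF f]]
        measurable_compose[OF measurable_snd borel_measurable_integrable[OF g]])+
  show "integrable (lborel \<Otimes>\<^sub>M lborel) (\<lambda>z. f (fst z) * g (snd z))"
  proof (rule lborel_pair.Fubini_integrable)
    show "integrable lborel (\<lambda>u. \<integral>v. norm (f (fst (u, v)) * g (snd (u, v))) \<partial>lborel)"
      using f g by (simp add: abs_mult)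
    show "AE u in lborel. integrable lborel (\<lambda>v. f (fst (u, v)) * g (snd (u, v)))"
      using g by simp
  qed (intro borel_measurable_times fm gm)
  show "(\<lambda>(u, v). f u * g v * c u v) \<in> borel_measurable (lborel \<Otimes>\<^sub>M lborel)"
    using borel_measurable_times[OF borel_measurable_times[OF fm gm] c] by (simp add: case_prod_beta')
  show "AE z in lborel \<Otimes>\<^sub>M lborel. norm (case z of (u, v) \<Rightarrow> f u * g v * c u v) \<le> norm (f (fst z) * g (snd z))"
    using c1 by (auto simp: abs_mult mult_left_le)
qed

text \<open>The hypotheses concern the identity map so that Lebesgue measure and the point mass at 0
  are both covered.\<close>

lemma abs_ratio_measurable_pair:
  assumes "(\<lambda>u. u) \<in> borel_measurable M1" "(\<lambda>u. u) \<in> borel_measurable M2"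
  shows "(\<lambda>(u, v). abs_ratio u v) \<in> borel_measurable (M1 \<Otimes>\<^sub>M M2)"
  unfolding case_prod_beta'
  by (intro abs_ratio_measurable measurable_compose[OF measurable_fst assms(1)] measurable_compose[OF measurable_snd assms(2)])

text \<open>Extending the weight by 0 turns integrals over the half line into integrals over the
  whole line; its zeros also allow the kernel to be changed off the positive axis.\<close>

definition half_line_weight :: "(real \<Rightarrow> real) \<Rightarrow> real \<Rightarrow> real \<Rightarrow> real" where
  "half_line_weight \<rho> t x = indicator {0<..} x * (exp (t * x) * \<rho> x)"

lemma beta_eq: "beta \<rho> t i = (\<integral>u. u ^ i * half_line_weight \<rho> t u \<partial>lborel)"
  by (simp add: beta_def set_lebesgue_integral_def half_line_weight_def mult_ac)

text \<open>The two kernels agree on the open quadrant, and elsewhere the weight vanishes.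
  Boundedness of the kernel justifies the iterated form that \<open>pfaffian_of_integrals\<close>
  expects.\<close>

lemma mu_eq:
  assumes int: "\<And>i. integrable lborel (\<lambda>u. u ^ i * half_line_weight \<rho> t u)"
  shows "mu \<rho> t i j = (\<integral>u. (\<integral>v. (u ^ i * half_line_weight \<rho> t u) * (v ^ j * half_line_weight \<rho> t v) * abs_ratio u v \<partial>lborel) \<partial>lborel)"
proof -
  have "mu \<rho> t i j = (\<integral>z. (case z of (u, v) \<Rightarrow> (u ^ i * half_line_weight \<rho> t u) * (v ^ j * half_line_weight \<rho> t v) * abs_ratio u v) \<partial>(lborel \<Otimes>\<^sub>M lborel))"
    unfolding mu_def set_lebesgue_integral_def
  proof (intro Bochner_Integration.integral_cong refl)
    fix z :: "real \<times> real"
    obtain u v where z: "z = (u, v)" by (cases z)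
    have "indicator ({0<..} \<times> {0<..}) (u, v) * (u ^ i * v ^ j * ((u - v) / (u + v)) * exp (t * (u + v)) * \<rho> u * \<rho> v)
        = (u ^ i * half_line_weight \<rho> t u) * (v ^ j * half_line_weight \<rho> t v) * abs_ratio u v"
    proof (cases "u > 0 \<and> v > 0")
      case True
      then have "abs_ratio u v = (u - v) / (u + v)" "half_line_weight \<rho> t u = exp (t * u) * \<rho> u" "half_line_weight \<rho> t v = exp (t * v) * \<rho> v"
        "indicator ({0<..} \<times> {0<..}) (u, v) = (1 :: real)"
        by (simp_all add: abs_ratio_def schur_ratio_def half_line_weight_def)
      moreover have "exp (t * (u + v)) = exp (t * u) * exp (t * v)"
        by (simp add: distrib_left exp_add)
      ultimately show ?thesis
        by (simp only: mult_1_left mult_ac)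
    qed (auto simp: half_line_weight_def)
    then show "indicator ({0<..} \<times> {0<..}) z *\<^sub>R
        (case z of (u, v) \<Rightarrow> u ^ i * v ^ j * ((u - v) / (u + v)) * exp (t * (u + v)) * \<rho> u * \<rho> v) =
        (case z of (u, v) \<Rightarrow> (u ^ i * half_line_weight \<rho> t u) * (v ^ j * half_line_weight \<rho> t v) * abs_ratio u v)"
      by (simp only: z case_prod_conv real_scaleR_def)
  qed
  also have "\<dots> = (\<integral>u. (\<integral>v. (u ^ i * half_line_weight \<rho> t u) * (v ^ j * half_line_weight \<rho> t v) * abs_ratio u v \<partial>lborel) \<partial>lborel)"
  proof -
    have "(\<lambda>u :: real. u) \<in> borel_measurable lborel" by simp
    note integrable_pair_bounded[OF int[of i] int[of j] abs_ratio_measurable_pair[OF this this] abs_ratio_bounded]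
    from lborel_pair.integral_fst'[OF this] show ?thesis
      by (simp only: case_prod_conv)
  qed
  finally show ?thesis .
qed

lemma schur_pfaffian_abs_ratio:
  assumes "\<And>i. Suc i < 2 * N \<Longrightarrow> x (Suc i) > 0" and "N > 0 \<Longrightarrow> x 0 \<ge> 0"
  shows "pfaffian N (\<lambda>i j. abs_ratio (x i) (x j)) = pair_prod abs_ratio (2 * N) x"
proof -
  have pos: "x i > 0" if "i < 2 * N" "i \<noteq> 0" for i
    using assms(1)[of "i - 1"] that by simp
  have nonneg: "x i \<ge> 0" if "i < 2 * N" for i
    using assms(2) pos[of i] that by (cases "i = 0") auto
  have "pfaffian N (\<lambda>i j. schur_ratio \<bar>x i\<bar> \<bar>x j\<bar>) = pair_prod schur_ratio (2 * N) (\<lambda>i. \<bar>x i\<bar>)"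
  proof (rule schur_pfaffian)
    fix i j assume "i < 2 * N" "j < 2 * N" "i \<noteq> j"
    then show "\<bar>x i\<bar> + \<bar>x j\<bar> > 0"
      using pos[of i] pos[of j] by (cases "i = 0") auto
  qed simp
  then show ?thesis
    by (simp add: abs_ratio_def[abs_def] pair_prod_def)
qed


lemma tau_eq_integral:
  assumes int: "\<And>i. integrable lborel (\<lambda>u. u ^ i * half_line_weight \<rho> t u)"
    and W: "half_line_weight \<rho> t \<in> borel_measurable borel"
  shows "tau \<rho> t n = (\<integral>x. (\<Prod>i<n. x i ^ i * half_line_weight \<rho> t (x i)) * pair_prod abs_ratio n x \<partial>Pi\<^sub>M {..<n} (\<lambda>_. lborel))"
proof (cases "even n")
  case True
  define N where "N = n div 2"
  have n: "n = 2 * N" using True by (simp add: N_def)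
  have "tau \<rho> t n = pfaffian N (\<lambda>i j. pf_entry \<rho> t (map Idx [0..<n] ! i) (map Idx [0..<n] ! j))"
    using True by (simp add: tau_def hirota_Pf_def N_def)
  also have "\<dots> = (\<integral>x. (\<Prod>i<2 * N. x i ^ i * half_line_weight \<rho> t (x i)) * pfaffian N (\<lambda>i j. abs_ratio (x i) (x j)) \<partial>Pi\<^sub>M {..<2 * N} (\<lambda>_. lborel))"
  proof (rule pfaffian_of_integrals(2)[OF lborel_product_sigma_finite int abs_ratio_measurable_pair abs_ratio_bounded])
    fix i j assume "i < 2 * N" "j < 2 * N"
    then show "pf_entry \<rho> t (map Idx [0..<n] ! i) (map Idx [0..<n] ! j)
        = (\<integral>u. (\<integral>v. (u ^ i * half_line_weight \<rho> t u) * (v ^ j * half_line_weight \<rho> t v) * abs_ratio u v \<partial>lborel) \<partial>lborel)"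
      using n by (simp add: mu_eq[OF int])
  qed simp_all
  also have "\<dots> = (\<integral>x. (\<Prod>i<n. x i ^ i * half_line_weight \<rho> t (x i)) * pair_prod abs_ratio n x \<partial>Pi\<^sub>M {..<n} (\<lambda>_. lborel))"
    unfolding n
  proof (intro Bochner_Integration.integral_cong refl)
    fix x :: "nat \<Rightarrow> real"
    show "(\<Prod>i<2 * N. x i ^ i * half_line_weight \<rho> t (x i)) * pfaffian N (\<lambda>i j. abs_ratio (x i) (x j))
        = (\<Prod>i<2 * N. x i ^ i * half_line_weight \<rho> t (x i)) * pair_prod abs_ratio (2 * N) x"
    \<comment> \<open>If some coordinate is not positive, the weights annihilate both sides.\<close>
    proof (cases "\<forall>i<2*N. x i > 0")
      case True
      then have "pfaffian N (\<lambda>i j. abs_ratio (x i) (x j)) = pair_prod abs_ratio (2 * N) x"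
        by (intro schur_pfaffian_abs_ratio) (auto simp: less_imp_le)
      then show ?thesis by simp
    next
      case False
      then obtain i where "i < 2 * N" "\<not> x i > 0" by blast
      then have "(\<Prod>i<2 * N. x i ^ i * half_line_weight \<rho> t (x i)) = 0"
        by (intro prod_zero) (auto simp: half_line_weight_def intro!: bexI[of _ i])
      then show ?thesis by simp
    qed
  qed
  finally show ?thesis .
next
  case False
  define N where "N = Suc n div 2"
  have n: "Suc n = 2 * N" using False by (auto simp: N_def elim: oddE)
  define sy where "sy = (D0 # map Idx [0..<n])"
  have sy: "sy ! 0 = D0" "\<And>i. i < n \<Longrightarrow> sy ! Suc i = Idx i"
    by (simp_all add: sy_def)
  \<comment> \<open>\<open>count_space {0}\<close> is the point mass at \<open>0\<close> carried by the row \<open>D0\<close>.\<close>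
  define M where "M i = (if i = 0 then count_space {0 :: real} else lborel)" for i :: nat
  have M: "M 0 = count_space {0}" "\<And>i. M (Suc i) = (lborel :: real measure)"
    by (simp_all add: M_def)
  \<comment> \<open>The weight -1 in row 0 cancels s(0, x) = -1, so the entry for \<open>D0\<close>
    and \<open>Idx i\<close> comes out as \<open>beta\<close> with a plus sign.\<close>
  define g where "g i u = (case i of 0 \<Rightarrow> -1 | Suc k \<Rightarrow> u ^ k * half_line_weight \<rho> t u)" for i :: nat and u :: real
  have g: "g 0 u = -1" "g (Suc k) u = u ^ k * half_line_weight \<rho> t u" for u k
    by (simp_all add: g_def)
  have M_id: "(\<lambda>u. u) \<in> borel_measurable (M i)" for i
    by (simp add: M_def)
  have PM: "product_sigma_finite M"
    unfolding product_sigma_finite_def M_def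
    by (auto intro: sigma_finite_lborel sigma_finite_measure_count_space_finite)
  interpret product_sigma_finite M by (rule PM)
  have g_int: "integrable (M i) (g i)" for i
    using int by (cases i) (simp_all add: M g[abs_def] integrable_count_space)
  have abs_ratio_0: "abs_ratio 0 u * half_line_weight \<rho> t u = - half_line_weight \<rho> t u" "abs_ratio u 0 * half_line_weight \<rho> t u = half_line_weight \<rho> t u" for u
    by (auto simp: abs_ratio_def schur_ratio_def half_line_weight_def)
  have at_0: "(\<integral>v. f v \<partial>count_space {0}) = f 0" for f :: "real \<Rightarrow> real"
    by (simp add: lebesgue_integral_count_space_finite)
  have cancel: "s * w = - w \<Longrightarrow> - 1 * (a * w) * s = a * w" "s * w = w \<Longrightarrow> a * w * - 1 * s = - (a * w)"
    for a w s :: real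
    by (simp_all add: mult.assoc) (simp_all add: mult.left_commute mult.commute)
  have entry: "pf_entry \<rho> t (sy ! i) (sy ! j) = (\<integral>u. (\<integral>v. g i u * g j v * abs_ratio u v \<partial>M j) \<partial>M i)"
    if ij: "i < 2 * N" "j < 2 * N" "i \<noteq> j" for i j
  proof (cases i)
    case 0
    then obtain k where j: "j = Suc k"
      using ij by (cases j) auto
    then have k: "k < n"
      using that n by simp
    have "- 1 * (v ^ k * half_line_weight \<rho> t v) * abs_ratio 0 v = v ^ k * half_line_weight \<rho> t v" for v
      by (rule cancel(1)[OF abs_ratio_0(1)])
    then show ?thesis
      unfolding 0 j sy(1) sy(2)[OF k] M g beta_eq pf_entry.simps at_0 by simp
  next
    case (Suc l)
    then have l: "l < n" using that n by simp
    show ?thesis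
    proof (cases j)
      case 0
      have "(\<integral>v. u ^ l * half_line_weight \<rho> t u * - 1 * abs_ratio u v \<partial>count_space {0}) = - (u ^ l * half_line_weight \<rho> t u)" for u
        unfolding at_0 by (rule cancel(2)[OF abs_ratio_0(2)])
      then show ?thesis
        unfolding 0 Suc sy(1) sy(2)[OF l] M g beta_eq pf_entry.simps by (simp only: Bochner_Integration.integral_minus)
    next
      fix k assume j: "j = Suc k"
      then have "k < n" using that n by simp
      then show ?thesis
        unfolding j Suc sy(2)[OF l] sy(2)[OF \<open>k < n\<close>] M g pf_entry.simps by (intro mu_eq int)
    qed
  qed
  define F where "F x = (\<Prod>i<2 * N. g i (x i)) * pfaffian N (\<lambda>i j. abs_ratio (x i) (x j))" for x
  define h where "h x = (\<Prod>i<n. x i ^ i * half_line_weight \<rho> t (x i)) * pair_prod abs_ratio n x" for x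
  have F_h: "F (x(0 := 0)) = h (\<lambda>j\<in>{..<n}. x (Suc j))" for x
  proof -
    let ?z = "x(0 := 0)"
    have prod: "(\<Prod>i<2 * N. g i (?z i)) = - (\<Prod>i<n. x (Suc i) ^ i * half_line_weight \<rho> t (x (Suc i)))"
      unfolding n[symmetric] prod.lessThan_Suc_shift by (simp add: g)
    have h: "h (\<lambda>j\<in>{..<n}. x (Suc j)) = (\<Prod>i<n. x (Suc i) ^ i * half_line_weight \<rho> t (x (Suc i))) * pair_prod abs_ratio n (x \<circ> Suc)"
      unfolding h_def by (intro arg_cong2[of _ _ _ _ "(*)"] prod.cong pair_prod_cong) auto
    show ?thesis
    proof (cases "\<forall>i<n. x (Suc i) > 0")
      case True
      then have "pfaffian N (\<lambda>i j. abs_ratio (?z i) (?z j)) = pair_prod abs_ratio (Suc n) ?z"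
        unfolding n by (intro schur_pfaffian_abs_ratio) (auto simp flip: n)
      also have "\<dots> = (\<Prod>j<n. abs_ratio 0 (x (Suc j))) * pair_prod abs_ratio n (x \<circ> Suc)"
        by (simp add: pair_prod_shift o_def)
      also have "(\<Prod>j<n. abs_ratio 0 (x (Suc j))) = (\<Prod>j<n. -1)"
        using True by (intro prod.cong) (auto simp: abs_ratio_def schur_ratio_def)
      \<comment> \<open>An odd number of factors -1; the result cancels against the weight -1 of row
        0.\<close>
      also have "\<dots> = -1"
        using \<open>odd n\<close> by simp
      finally show ?thesis
        unfolding F_def prod h by (simp only: minus_mult_commute mult_minus1 mult_minus1_right minus_minus)
    next
      case False
      then obtain i where "i < n" "\<not> x (Suc i) > 0" by blast
      then have "(\<Prod>i<n. x (Suc i) ^ i * half_line_weight \<rho> t (x (Suc i))) = 0"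
        by (intro prod_zero) (auto simp: half_line_weight_def intro!: bexI[of _ i])
      then show ?thesis
        unfolding F_def prod h by (simp only: mult_zero_left minus_zero)
    qed
  qed
  have "tau \<rho> t n = pfaffian N (\<lambda>i j. pf_entry \<rho> t (sy ! i) (sy ! j))"
    using False by (simp add: tau_def hirota_Pf_def N_def sy_def)
  also have "\<dots> = integral\<^sup>L (Pi\<^sub>M {..<2 * N} M) F"
    unfolding F_def
    by (rule pfaffian_of_integrals(2)[OF PM g_int abs_ratio_measurable_pair[OF M_id M_id] abs_ratio_bounded entry])
  also have "\<dots> = integral\<^sup>L (Pi\<^sub>M (insert 0 (Suc ` {..<n})) M) F"
    by (simp only: n[symmetric] lessThan_Suc_eq_insert_0)
  \<comment> \<open>Integrating coordinate 0 against its point mass just evaluates \<open>F\<close>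
    at 0.\<close>
  also have "\<dots> = (\<integral>x. (\<integral>y. F (x(0 := y)) \<partial>M 0) \<partial>Pi\<^sub>M (Suc ` {..<n}) M)"
  proof (rule product_integral_insert)
    show "integrable (Pi\<^sub>M (insert 0 (Suc ` {..<n})) M) F"
      unfolding F_def lessThan_Suc_eq_insert_0[symmetric] n
      by (rule pfaffian_of_integrals(1)[OF PM g_int abs_ratio_measurable_pair[OF M_id M_id] abs_ratio_bounded entry])
  qed auto
  also have "\<dots> = (\<integral>x. h (\<lambda>j\<in>{..<n}. x (Suc j)) \<partial>Pi\<^sub>M (Suc ` {..<n}) M)"
    by (simp add: M lebesgue_integral_count_space_finite F_h)
  also have "\<dots> = integral\<^sup>L (Pi\<^sub>M {..<n} (\<lambda>_. lborel)) h"
  proof -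
    have comp: "(\<lambda>x. x i) \<in> borel_measurable (Pi\<^sub>M {..<n} (\<lambda>_. lborel :: real measure))" if "i < n" for i
      using measurable_component_singleton[of i "{..<n}" "\<lambda>_. lborel :: real measure"] that by simp
    have h_meas: "h \<in> borel_measurable (Pi\<^sub>M {..<n} (\<lambda>_. lborel))"
      unfolding h_def[abs_def] pair_prod_def
      by (intro borel_measurable_times borel_measurable_prod borel_measurable_power abs_ratio_measurable comp
          measurable_compose[OF comp W]) auto
    have "(\<lambda>x. \<lambda>j\<in>{..<n}. x (Suc j)) \<in> Pi\<^sub>M (Suc ` {..<n}) M \<rightarrow>\<^sub>M Pi\<^sub>M {..<n} (\<lambda>j. M (Suc j))"
      by (intro measurable_restrict measurable_component_singleton) auto
    moreover have "bij_betw Suc {..<n} (Suc ` {..<n})"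
      by (simp add: bij_betw_def)
    ultimately show ?thesis
      using integral_distr[of "\<lambda>x. \<lambda>j\<in>{..<n}. x (Suc j)" "Pi\<^sub>M (Suc ` {..<n}) M" "Pi\<^sub>M {..<n} (\<lambda>_. lborel)" h] h_meas
        distr_PiM_reindex_bij[of "{..<n}" Suc "Suc ` {..<n}"] by (simp add: M(2))
  qed
  finally show ?thesis
    by (simp add: h_def[abs_def])
qed

theorem mainTheorem5:
  fixes \<rho> :: "real \<Rightarrow> real" and t :: real and n :: nat
  assumes "set_borel_measurable borel {0<..} \<rho>"
    and "\<And>x. x > 0 \<Longrightarrow> \<rho> x > 0"
    and "\<And>i::nat. set_integrable lborel {0<..} (\<lambda>x. x ^ i * exp (t * x) * \<rho> x)"
    and "n \<ge> 1"
  shows "tau \<rho> t n =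
    (-1) ^ (n div 2) *
    (LINT x:ordered_chamber n|Pi\<^sub>M {..<n} (\<lambda>_. lborel).
       (\<Prod>j<n. \<Prod>i<j. (x j - x i)\<^sup>2 / (x i + x j)) * (\<Prod>j<n. exp (t * x j) * \<rho> (x j)))"
proof -
  let ?P = "Pi\<^sub>M {..<n} (\<lambda>_. lborel :: real measure)"
  let ?C = "indicator (ordered_chamber n) :: _ \<Rightarrow> real"
  define W where "W = half_line_weight \<rho> t"
  have W_meas: "W \<in> borel_measurable borel"
  proof -
    have "(\<lambda>x. exp (t * x) * (indicator {0<..} x *\<^sub>R \<rho> x)) \<in> borel_measurable borel"
      using assms(1) unfolding set_borel_measurable_def by (intro borel_measurable_times) simp_all
    then show ?thesis
      by (simp add: W_def half_line_weight_def[abs_def] mult_ac)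
  qed
  have int: "integrable lborel (\<lambda>u. u ^ i * W u)" for i
    using assms(3)[of i] by (simp add: set_integrable_def W_def half_line_weight_def mult_ac)
  define h where "h x = (\<Prod>i<n. x i ^ i * W (x i)) * pair_prod abs_ratio n x" for x
  have comp: "(\<lambda>x. x i) \<in> borel_measurable ?P" if "i < n" for i
    using measurable_component_singleton[of i "{..<n}" "\<lambda>_. lborel :: real measure"] that by simp
  have h_int: "integrable ?P h"
    unfolding h_def[abs_def]
  proof (rule product_sigma_finite.integrable_prod_times_bounded[OF lborel_product_sigma_finite])
    show "(\<lambda>x. pair_prod abs_ratio n x) \<in> borel_measurable ?P"
      unfolding pair_prod_def by (intro borel_measurable_prod abs_ratio_measurable comp) auto
    show "\<bar>pair_prod abs_ratio n x\<bar> \<le> 1" for x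
      unfolding pair_prod_def abs_prod using abs_ratio_bounded by (intro prod_le_1 conjI prod_nonneg) auto
  qed (use int in auto)
  have h_zero: "h x = 0" if "i < n" "x i \<le> 0" for x i
  proof -
    have "(\<Prod>i<n. x i ^ i * W (x i)) = 0"
      using that by (intro prod_zero) (auto simp: W_def half_line_weight_def intro!: bexI[of _ i])
    then show ?thesis by (simp add: h_def)
  qed
  have on_chamber: "(\<Sum>q | q permutes {..<n}. h (\<lambda>i\<in>{..<n}. x (q i)))
      = (-1) ^ (n div 2) * ((\<Prod>j<n. \<Prod>i<j. (x j - x i)\<^sup>2 / (x i + x j)) * (\<Prod>j<n. exp (t * x j) * \<rho> (x j)))"
    if x: "x \<in> ordered_chamber n" for x
  proof -
    have pos: "0 < x i" if "i < n" for i
      using x that by (simp add: ordered_chamber_def)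
    have inj: "inj_on x {..<n}"
    proof (rule linorder_inj_onI)
      fix i j assume "i < j" "i \<in> {..<n}" "j \<in> {..<n}"
      then have "x i < x j"
        using x by (simp add: ordered_chamber_def)
      then show "x i \<noteq> x j" by simp
    qed auto
    have "h (\<lambda>i\<in>{..<n}. x (q i)) = (\<Prod>i<n. W (x i)) * pair_prod abs_ratio n x * (of_int (sign q) * (\<Prod>i<n. x (q i) ^ i))"
      if q: "q permutes {..<n}" for q
    proof -
      have "h (\<lambda>i\<in>{..<n}. x (q i)) = (\<Prod>i<n. x (q i) ^ i * W (x (q i))) * pair_prod abs_ratio n (x \<circ> q)"
        unfolding h_def by (intro arg_cong2[of _ _ _ _ "(*)"] prod.cong pair_prod_cong) auto
      \<comment> \<open>The exponent stays with the position while the variable moves; the weights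
        form a symmetric product. So only the monomial and, through antisymmetry, the sign depend on
        \<open>q\<close>.\<close>
      also have "(\<Prod>i<n. x (q i) ^ i * W (x (q i))) = (\<Prod>i<n. x (q i) ^ i) * (\<Prod>i<n. W (x i))"
        using prod.permute[OF q, of "\<lambda>i. W (x i)"] by (simp add: prod.distrib o_def)
      also have "pair_prod abs_ratio n (x \<circ> q) = of_int (sign q) * pair_prod abs_ratio n x"
        by (rule pair_prod_permutes[OF abs_ratio_antisym q])
      finally show ?thesis by (simp only: mult_ac)
    qed
    then have "(\<Sum>q | q permutes {..<n}. h (\<lambda>i\<in>{..<n}. x (q i)))
        = (\<Prod>i<n. W (x i)) * pair_prod abs_ratio n x * pair_prod (\<lambda>u v. v - u) n x"
      unfolding vandermonde_sum_permutations[OF inj, symmetric] sum_distrib_left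
      by (intro sum.cong refl) simp
    also have "pair_prod abs_ratio n x = pair_prod schur_ratio n x"
      unfolding pair_prod_def by (intro prod.cong refl) (use pos in \<open>auto simp: abs_ratio_def abs_of_pos\<close>)
    also have "(\<Prod>i<n. W (x i)) = (\<Prod>j<n. exp (t * x j) * \<rho> (x j))"
      using pos by (intro prod.cong) (auto simp: W_def half_line_weight_def)
    also have "(\<Prod>j<n. exp (t * x j) * \<rho> (x j)) * pair_prod schur_ratio n x * pair_prod (\<lambda>u v. v - u) n x
        = (\<Prod>j<n. exp (t * x j) * \<rho> (x j)) * (pair_prod (\<lambda>u v. v - u) n x * pair_prod schur_ratio n x)"
      by (simp only: mult_ac)
    also have "\<dots> = (-1) ^ (n div 2) * ((\<Prod>j<n. \<Prod>i<j. (x j - x i)\<^sup>2 / (x i + x j)) * (\<Prod>j<n. exp (t * x j) * \<rho> (x j)))"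
      unfolding vandermonde_times_schur_product by (simp only: mult_ac)
    finally show ?thesis .
  qed
  have "tau \<rho> t n = integral\<^sup>L ?P h"
    using tau_eq_integral[of \<rho> t n] int W_meas by (simp add: W_def h_def[abs_def])
  also have "\<dots> = (LINT x:ordered_chamber n|?P. \<Sum>q | q permutes {..<n}. h (\<lambda>i\<in>{..<n}. x (q i)))"
    by (rule integral_eq_integral_ordered_chamber[OF h_int h_zero])
  also have "\<dots> = (LINT x:ordered_chamber n|?P. (-1) ^ (n div 2) *
      ((\<Prod>j<n. \<Prod>i<j. (x j - x i)\<^sup>2 / (x i + x j)) * (\<Prod>j<n. exp (t * x j) * \<rho> (x j))))"
    unfolding set_lebesgue_integral_def
  proof (intro Bochner_Integration.integral_cong refl)
    fix x
    show "?C x *\<^sub>R (\<Sum>q | q permutes {..<n}. h (\<lambda>i\<in>{..<n}. x (q i))) = ?C x *\<^sub>R ((-1) ^ (n div 2) *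
      ((\<Prod>j<n. \<Prod>i<j. (x j - x i)\<^sup>2 / (x i + x j)) * (\<Prod>j<n. exp (t * x j) * \<rho> (x j))))"
      by (cases "x \<in> ordered_chamber n") (simp_all only: on_chamber indicator_simps scaleR_zero_left simp_thms)
  qed
  also have "\<dots> = (-1) ^ (n div 2) * (LINT x:ordered_chamber n|?P.
      (\<Prod>j<n. \<Prod>i<j. (x j - x i)\<^sup>2 / (x i + x j)) * (\<Prod>j<n. exp (t * x j) * \<rho> (x j)))"
    unfolding set_lebesgue_integral_def by (simp only: mult_scaleR_right[symmetric] integral_mult_right_zero)
  finally show ?thesis .
qed

end
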